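(* Let $X$ be a random graph in $\mathcal{G}(K_{r,r},p)$, where $p = p(r)$ depends on $r$. Let $\omega(r)$ be a function of $r$ such that $\omega(r) \to \infty$ as $r \to \infty$. (1) If $p = \dfrac{\log r - \omega(r)}{r}$ and $p \geq 0$, then the friends-and-strangers graph $\mathsf{FS}(X, K_{r,r})$ has more than two connected components with high probability. (2) If $p = \dfrac{\log r + \omega(r)}{r}$ and $p \leq 1$, then $\mathsf{FS}(X,K_{r,r})$ has exactly two connected components with high probability.
   Context: All graphs are simple. $K_{r,r}$ is the complete bipartite graph whose two partite sets both have size $r$. An edge-subgraph of a graph $G$ is a graph with the same vertex set as $G$ whose edge set is a subset of $E(G)$. $\mathcal{G}(G,p)$ denotes the probability space of edge-subgraphs of $G$ in which each edge of $G$ appears independently with probability $p$. "With high probability" means with probability tending to $1$ as $r \to \infty$. $\log$ is the natural logarithm. For simple graphs $X$ and $Y$ on $n$ vertices each, the friends-and-strangers graph $\mathsf{FS}(X,Y)$ is the graph whose vertices are all bijections $V(X) \to V(Y)$, in which two bijections $\sigma, \tau$ are adjacent if and only if there is an edge $\{a,b\} \in E(X)$ such that $\{\sigma(a),\sigma(b)\} \in E(Y)$, $\sigma(a)=\tau(b)$, $\sigma(b)=\tau(a)$, and $\sigma(c)=\tau(c)$ for all $c \in V(X)\setminus\{a,b\}$. *)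

theory Defs
  imports "HOL-Probability.Probability"
begin

record 'a graph =
  verts :: "'a set"
  edges :: "'a set set"

definition simple_graph :: "'a graph \<Rightarrow> bool" where
  "simple_graph G \<longleftrightarrow> (\<forall>e\<in>edges G. e \<subseteq> verts G \<and> card e = 2)"

definition complete_bipartite :: "nat \<Rightarrow> nat \<Rightarrow> (nat + nat) graph" where
  "complete_bipartite m n =
     \<lparr>verts = {..<m} <+> {..<n},
      edges = {{Inl i, Inr j} | i j. i < m \<and> j < n}\<rparr>"

lemma simple_complete_bipartite: "simple_graph (complete_bipartite m n)"
  by (auto simp: simple_graph_def complete_bipartite_def)

definition edge_subgraphs :: "'a graph \<Rightarrow> 'a graph set" where
  "edge_subgraphs G = {H. verts H = verts G \<and> edges H \<subseteq> edges G}"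

lemma simple_edge_subgraph:
  "simple_graph G \<Longrightarrow> H \<in> edge_subgraphs G \<Longrightarrow> simple_graph H"
  by (auto simp: simple_graph_def edge_subgraphs_def)

text \<open>
  The indicators of the edges are independent Bernoulli variables. This is meant for a finite
  edge set and \<^prop>\<open>0 \<le> p \<and> p \<le> 1\<close>; other values of \<^term>\<open>p\<close> are truncated
  to the unit interval by \<^const>\<open>bernoulli_pmf\<close>.
\<close>
definition random_edge_subgraph :: "'a graph \<Rightarrow> real \<Rightarrow> 'a graph pmf" where
  "random_edge_subgraph G p =
     map_pmf (\<lambda>present. \<lparr>verts = verts G, edges = {e \<in> edges G. present e}\<rparr>)
       (Pi_pmf (edges G) False (\<lambda>_. bernoulli_pmf p))"

lemma set_random_edge_subgraph: "set_pmf (random_edge_subgraph G p) \<subseteq> edge_subgraphs G"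
  by (auto simp: random_edge_subgraph_def edge_subgraphs_def)

text \<open>
  Bijections between the vertex sets are total functions normalised to \<^const>\<open>undefined\<close>
  outside \<^term>\<open>verts X\<close>, so that each bijection is counted exactly once.
\<close>
definition FS :: "'a graph \<Rightarrow> 'b graph \<Rightarrow> ('a \<Rightarrow> 'b) graph" where
  "FS X Y =
     (let B = {\<sigma> \<in> extensional (verts X). bij_betw \<sigma> (verts X) (verts Y)}
      in \<lparr>verts = B,
          edges = {{\<sigma>, \<tau>} | \<sigma> \<tau>. \<sigma> \<in> B \<and> \<tau> \<in> B \<and>
            (\<exists>a b. {a, b} \<in> edges X \<and> {\<sigma> a, \<sigma> b} \<in> edges Y \<and>
               \<sigma> a = \<tau> b \<and> \<sigma> b = \<tau> a \<and>
               (\<forall>c \<in> verts X - {a, b}. \<sigma> c = \<tau> c))}\<rparr>)"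

lemma simple_FS:
  fixes X :: "'a graph" and Y :: "'b graph"
  assumes "simple_graph Y"
  shows "simple_graph (FS X Y)"
proof -
  have neq: "\<sigma> \<noteq> \<tau>" if "{\<sigma> a, \<sigma> b} \<in> edges Y" "\<sigma> a = \<tau> b" for \<sigma> \<tau> :: "'a \<Rightarrow> 'b" and a b
  proof
    assume "\<sigma> = \<tau>"
    with that have "{\<sigma> a} \<in> edges Y" by simp
    with assms have "card {\<sigma> a} = 2" unfolding simple_graph_def by blast
    then show False by simp
  qed
  have "e \<subseteq> verts (FS X Y) \<and> card e = 2" if "e \<in> edges (FS X Y)" for e
  proof -
    from that obtain \<sigma> \<tau> a b where e: "e = {\<sigma>, \<tau>}"
      and v: "\<sigma> \<in> verts (FS X Y)" "\<tau> \<in> verts (FS X Y)"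
      and ab: "{\<sigma> a, \<sigma> b} \<in> edges Y" "\<sigma> a = \<tau> b"
      unfolding FS_def Let_def graph.simps mem_Collect_eq by (elim exE conjE) metis
    from neq[of \<sigma> a b \<tau>, OF ab] e v show ?thesis by simp
  qed
  then show ?thesis by (simp add: simple_graph_def)
qed

definition reachable :: "'a graph \<Rightarrow> ('a \<times> 'a) set" where
  "reachable G = {(u, v). u \<in> verts G \<and> v \<in> verts G \<and> (u, v) \<in> {(x, y). {x, y} \<in> edges G}\<^sup>*}"

definition graph_components :: "'a graph \<Rightarrow> 'a set set" where
  "graph_components G = verts G // reachable G"

lemma equiv_reachable: "equiv (verts G) (reachable G)"
proof (rule equivI)
  have "sym ({(x, y). {x, y} \<in> edges G}\<^sup>*)"
    by (rule sym_rtrancl) (auto simp: sym_def insert_commute)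
  then show "sym (reachable G)"
    by (auto simp: reachable_def sym_def)
  show "trans (reachable G)"
    by (auto simp: reachable_def trans_def)
qed (auto simp: reachable_def refl_on_def)

end

theory Submission
  imports Defs "HOL-Real_Asymp.Real_Asymp"
begin

text \<open>
  (1) If \<open>r (1 - p)\<^sup>r \<rightarrow> \<infinity>\<close>, then \<open>X\<close> has an isolated vertex with high probability, and the person
  standing there never moves, so there are at least \<open>2 r\<close> components.

  (2) There are at least two components by parity: every move is a transposition and changes the
  number of left persons on left locations by one. For the upper bound call a vertex set \<open>S\<close> full
  for \<open>c\<close> if, whenever both colours of people occur at least \<open>c\<close> times on \<open>S\<close>, the moves inside
  \<open>S\<close> produce at most two classes of arrangements. A star with three leaves is full for 2. Attaching
  a new vertex to a vertex of \<open>S\<close> costs at most one unit of \<open>c\<close>, and it costs nothing if that vertex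
  already has two neighbours in \<open>S\<close>. So all neighbours of a vertex can be attached for one unit.
  With high probability \<open>X\<close> is connected and has an edge between any two large subsets of the two
  sides. Hence one first attaches at least three new vertices per unit until \<open>S\<close> has linear size,
  and then reaches everything by processing a small dominating set and the paths to it; the total
  cost stays below \<open>r\<close>.
\<close>

hide_const (open) Finite_Cartesian_Product.transpose

section \<open>Swapping people of different colours\<close>

text \<open>Near the threshold \<open>X\<close> may have vertices of degree one, so degrees give no
  control, and attaching the \<open>2 * r\<close> vertices one by one at a unit each would cost more
  than \<open>r\<close>. The budget is \<open>r\<close> because each colour has \<open>r\<close>
  people: \<open>full V r\<close> then covers every arrangement. A pendant vertex costs a unit
  because the person standing on it is lost for the count on \<open>S\<close>. At a branching
  nothing is lost as long as \<open>2 * c \<le> card S\<close>, since then some colour has a person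
  to spare on \<open>insert v S\<close>. So the size of \<open>S\<close> must stay at least twice
  the cost, and at the end this very inequality keeps the cost within \<open>r\<close>. Gaining
  three vertices per unit makes the surplus \<open>card S - 2 * c\<close> proportional to
  \<open>card S\<close>; the surplus pays for the last stage, in which the gain per unit is not
  controlled. Vertices that obstruct the growth are set aside in a small set \<open>B\<close> and
  are only absorbed in that last stage.\<close>

locale token_swapping =
  fixes E :: "'a \<Rightarrow> 'a \<Rightarrow> bool" and col :: "'b \<Rightarrow> bool"
  assumes sym: "E a b \<Longrightarrow> E b a" and irrefl: "\<not> E a a"
begin

definition step :: "'a set \<Rightarrow> ('a \<Rightarrow> 'b) \<Rightarrow> ('a \<Rightarrow> 'b) \<Rightarrow> bool" where
  "step S \<sigma> \<tau> \<longleftrightarrow>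
     (\<exists>a\<in>S. \<exists>b\<in>S. E a b \<and> col (\<sigma> a) \<noteq> col (\<sigma> b) \<and> \<tau> = \<sigma> \<circ> transpose a b)"

abbreviation reach :: "'a set \<Rightarrow> ('a \<Rightarrow> 'b) \<Rightarrow> ('a \<Rightarrow> 'b) \<Rightarrow> bool" where
  "reach S \<equiv> (step S)\<^sup>*\<^sup>*"

definition cnt :: "'a set \<Rightarrow> ('a \<Rightarrow> 'b) \<Rightarrow> bool \<Rightarrow> nat" where
  "cnt S \<sigma> k = card {s \<in> S. col (\<sigma> s) = k}"

text \<open>
  A formulation without parities: the arrangements \<open>\<tau>\<close> and \<open>transpose x y \<circ> \<tau>\<close> stand for the two
  classes. All arrangements are global bijections, so agreement outside \<open>S\<close> means that the same
  people are on \<open>S\<close>.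
\<close>
definition full :: "'a set \<Rightarrow> nat \<Rightarrow> bool" where
  "full S c \<longleftrightarrow>
     (\<forall>\<sigma> \<tau> x y. bij \<sigma> \<longrightarrow> bij \<tau> \<longrightarrow> (\<forall>v. v \<notin> S \<longrightarrow> \<sigma> v = \<tau> v) \<longrightarrow> (\<forall>k. c \<le> cnt S \<sigma> k) \<longrightarrow>
        x \<in> \<sigma> ` S \<longrightarrow> y \<in> \<sigma> ` S \<longrightarrow> x \<noteq> y \<longrightarrow> col x = col y \<longrightarrow>
        reach S \<sigma> \<tau> \<or> reach S \<sigma> (transpose x y \<circ> \<tau>))"

lemma fullD:
  assumes "full S c" "bij \<sigma>" "bij \<tau>" "\<And>v. v \<notin> S \<Longrightarrow> \<sigma> v = \<tau> v" "\<And>k. c \<le> cnt S \<sigma> k"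
    "x \<in> \<sigma> ` S" "y \<in> \<sigma> ` S" "x \<noteq> y" "col x = col y"
  shows "reach S \<sigma> \<tau> \<or> reach S \<sigma> (transpose x y \<circ> \<tau>)"
  using assms unfolding full_def by blast

lemma step_sym: "step S \<sigma> \<tau> \<Longrightarrow> step S \<tau> \<sigma>"
  unfolding step_def
proof (elim bexE conjE)
  fix a b assume "a \<in> S" "b \<in> S" "E a b" "col (\<sigma> a) \<noteq> col (\<sigma> b)" "\<tau> = \<sigma> \<circ> transpose a b"
  then show "\<exists>a\<in>S. \<exists>b\<in>S. E a b \<and> col (\<tau> a) \<noteq> col (\<tau> b) \<and> \<sigma> = \<tau> \<circ> transpose a b"
    by (intro bexI[of _ a] bexI[of _ b]) (auto simp: comp_assoc)
qed

lemma reach_sym: "reach S \<sigma> \<tau> \<Longrightarrow> reach S \<tau> \<sigma>"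
  using symp_rtranclp[of "step S"] step_sym by (auto simp: symp_def)

lemma reach_mono: "reach S \<sigma> \<tau> \<Longrightarrow> S \<subseteq> T \<Longrightarrow> reach T \<sigma> \<tau>"
  by (rule rtranclp_mono[THEN predicate2D, of "step S"]) (unfold step_def, blast+)

lemma reach_swap:
  assumes "a \<in> S" "b \<in> S" "E a b" "col (\<sigma> a) \<noteq> col (\<sigma> b)"
  shows "reach S \<sigma> (\<sigma> \<circ> transpose a b)"
  using assms unfolding step_def by (intro r_into_rtranclp) auto

lemma reach_bij: "reach S \<sigma> \<tau> \<Longrightarrow> bij \<sigma> \<Longrightarrow> bij \<tau>"
  by (induction rule: rtranclp_induct) (auto simp: step_def intro!: bij_comp)

lemma reach_outside: "reach S \<sigma> \<tau> \<Longrightarrow> v \<notin> S \<Longrightarrow> \<tau> v = \<sigma> v"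
proof (induction rule: rtranclp_induct)
  case (step \<tau> \<upsilon>)
  then obtain a b where "a \<in> S" "b \<in> S" "\<upsilon> = \<tau> \<circ> transpose a b" unfolding step_def by blast
  moreover from this step.prems have "transpose a b v = v" by (intro transpose_apply_other) auto
  ultimately show ?case using step by simp
qed simp

lemma bij_image_eq:
  assumes "bij \<sigma>" "bij \<tau>" "\<And>v. v \<notin> S \<Longrightarrow> \<sigma> v = \<tau> v"
  shows "\<sigma> ` S = \<tau> ` S"
proof -
  have "\<sigma> ` (- S) = \<tau> ` (- S)" using assms(3) by (intro image_cong) auto
  then show ?thesis using assms(1,2) by (metis bij_image_Compl_eq double_complement)
qed

lemma reach_image: "reach S \<sigma> \<tau> \<Longrightarrow> bij \<sigma> \<Longrightarrow> \<tau> ` S = \<sigma> ` S"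
  using bij_image_eq[of \<tau> \<sigma> S] reach_bij reach_outside by metis

lemma cnt_alt:
  assumes "bij \<sigma>"
  shows "cnt S \<sigma> k = card {x \<in> \<sigma> ` S. col x = k}"
proof -
  have "{x \<in> \<sigma> ` S. col x = k} = \<sigma> ` {s \<in> S. col (\<sigma> s) = k}"
    by (rule Compr_image_eq)
  moreover have "inj_on \<sigma> {s \<in> S. col (\<sigma> s) = k}"
    using assms by (meson bij_is_inj inj_on_subset subset_UNIV)
  ultimately show ?thesis unfolding cnt_def by (simp add: card_image)
qed

lemma reach_cnt:
  assumes "reach S \<sigma> \<tau>" "bij \<sigma>"
  shows "cnt S \<tau> k = cnt S \<sigma> k"
  unfolding cnt_alt[OF assms(2)] cnt_alt[OF reach_bij[OF assms]] reach_image[OF assms] ..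

text \<open>Moves look only at colours, so renaming people within their colour commutes with them.
  In particular the ambiguity \<open>transpose x y\<close> in \<open>full\<close> can be carried
  along any sequence of moves.\<close>

lemma reach_relabel:
  assumes "reach S \<sigma> \<tau>" "\<And>x. col (\<pi> x) = col x"
  shows "reach S (\<pi> \<circ> \<sigma>) (\<pi> \<circ> \<tau>)"
  using assms(1)
proof (induction rule: rtranclp_induct)
  case (step \<tau> \<upsilon>)
  then have "step S (\<pi> \<circ> \<tau>) (\<pi> \<circ> \<upsilon>)"
    using assms(2) unfolding step_def by (auto simp: comp_assoc)
  with step.IH show ?case by (rule rtranclp.rtrancl_into_rtrancl[where r = "step S"])
qed simp

lemma reach_transpose_relabel:
  "reach S \<sigma> \<tau> \<Longrightarrow> col x = col y \<Longrightarrow> reach S (transpose x y \<circ> \<sigma>) (transpose x y \<circ> \<tau>)"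
  by (rule reach_relabel) (auto simp: Transposition.transpose_def)

lemma reach_via:
  assumes "reach S \<sigma> \<sigma>'" "reach S \<tau> \<tau>'" "col x = col y"
    and "reach S \<sigma>' \<tau>' \<or> reach S \<sigma>' (transpose x y \<circ> \<tau>')"
  shows "reach S \<sigma> \<tau> \<or> reach S \<sigma> (transpose x y \<circ> \<tau>)"
  using assms(4)
proof
  assume "reach S \<sigma>' \<tau>'"
  then show ?thesis using assms(1) reach_sym[OF assms(2)] by (meson rtranclp_trans)
next
  assume "reach S \<sigma>' (transpose x y \<circ> \<tau>')"
  then show ?thesis
    using assms(1) reach_transpose_relabel[OF reach_sym[OF assms(2)] assms(3)] by (meson rtranclp_trans)
qed

lemma ex_cnt:
  assumes "bij \<sigma>" "1 \<le> cnt S \<sigma> k"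
  obtains x where "x \<in> \<sigma> ` S" "col x = k"
proof -
  have "{x \<in> \<sigma> ` S. col x = k} \<noteq> {}"
    using assms by (metis card.empty cnt_alt not_one_le_zero)
  then show ?thesis using that by auto
qed

lemma ex2_cnt:
  assumes "bij \<sigma>" "2 \<le> cnt S \<sigma> k"
  obtains x y where "x \<in> \<sigma> ` S" "y \<in> \<sigma> ` S" "x \<noteq> y" "col x = k" "col y = k"
proof -
  obtain T where "T \<subseteq> {x \<in> \<sigma> ` S. col x = k}" "card T = 2"
    using assms by (metis cnt_alt obtain_subset_with_card_n)
  moreover from this obtain x y where "T = {x, y}" "x \<noteq> y" by (auto simp: card_2_iff)
  ultimately show ?thesis using that[of x y] by blast
qed

lemma cnt_insert:
  assumes "finite S" "v \<notin> S"
  shows "cnt (insert v S) \<sigma> k = (if col (\<sigma> v) = k then Suc (cnt S \<sigma> k) else cnt S \<sigma> k)"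
proof -
  have "{s \<in> insert v S. col (\<sigma> s) = k} =
      (if col (\<sigma> v) = k then insert v {s \<in> S. col (\<sigma> s) = k} else {s \<in> S. col (\<sigma> s) = k})" by auto
  then show ?thesis using assms unfolding cnt_def by simp
qed

lemma cnt_sum: "finite S \<Longrightarrow> cnt S \<sigma> k + cnt S \<sigma> (\<not> k) = card S"
  unfolding cnt_def
  by (subst card_Un_disjoint[symmetric]) (auto intro!: arg_cong[where f = card])

lemma place:
  assumes "bij \<sigma>" "p \<in> S" "x \<in> \<sigma> ` S"
  obtains \<tau> where "bij \<tau>" "\<And>v. v \<notin> S \<Longrightarrow> \<sigma> v = \<tau> v" "\<tau> p = x"
    "\<And>v. v \<noteq> p \<Longrightarrow> \<sigma> v \<noteq> x \<Longrightarrow> \<tau> v = \<sigma> v"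
proof -
  obtain b where b: "b \<in> S" "\<sigma> b = x" using assms by auto
  show ?thesis
    by (rule that[of "\<sigma> \<circ> transpose p b"])
       (use assms b in \<open>auto intro!: bij_comp simp: Transposition.transpose_def\<close>)
qed

section \<open>Steering people inside a full set\<close>

text \<open>The two outcomes in \<open>full\<close> become harmless when the ambiguous pair
  \<open>x\<close>, \<open>y\<close> is taken from the colour opposite to \<open>u\<close>: either
  outcome leaves \<open>u\<close> on \<open>w\<close>.\<close>

lemma bring:
  assumes "full S c" "2 \<le> c" "bij \<sigma>" "\<And>k. c \<le> cnt S \<sigma> k" "w \<in> S" "u \<in> \<sigma> ` S"
  obtains \<tau> where "reach S \<sigma> \<tau>" "\<tau> w = u"
proof -
  have "2 \<le> cnt S \<sigma> (\<not> col u)" using assms(2,4) le_trans by blast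
  then obtain x y where xy: "x \<in> \<sigma> ` S" "y \<in> \<sigma> ` S" "x \<noteq> y" "col x = (\<not> col u)" "col y = (\<not> col u)"
    using ex2_cnt assms(3) by blast
  obtain \<tau> where \<tau>: "bij \<tau>" "\<And>v. v \<notin> S \<Longrightarrow> \<sigma> v = \<tau> v" "\<tau> w = u"
    using place[OF assms(3,5,6)] by blast
  have "reach S \<sigma> \<tau> \<or> reach S \<sigma> (transpose x y \<circ> \<tau>)"
    by (rule fullD[OF assms(1,3) \<tau>(1,2) assms(4)]) (use xy in auto)
  moreover have "(transpose x y \<circ> \<tau>) w = u" using \<tau>(3) xy by (auto simp: Transposition.transpose_def)
  ultimately show ?thesis using that \<tau>(3) by blast
qed

text \<open>Here the ambiguous pair itself is put on \<open>w\<close> and \<open>y2\<close>, so both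
  outcomes show the same colours there. This is the position from which \<open>bring_branch\<close>
  starts the overtaking.\<close>

lemma bring3:
  assumes "full S c" "2 \<le> c" "bij \<sigma>" "\<And>k. c \<le> cnt S \<sigma> k" "w \<in> S" "y1 \<in> S" "y2 \<in> S"
    "distinct [w, y1, y2]" "u \<in> \<sigma> ` S"
  obtains \<tau> where "reach S \<sigma> \<tau>" "\<tau> y1 = u" "col (\<tau> w) \<noteq> col u" "col (\<tau> y2) \<noteq> col u"
proof -
  have "2 \<le> cnt S \<sigma> (\<not> col u)" using assms(2,4) le_trans by blast
  then obtain x y where xy: "x \<in> \<sigma> ` S" "y \<in> \<sigma> ` S" "x \<noteq> y" "col x = (\<not> col u)" "col y = (\<not> col u)"
    using ex2_cnt assms(3) by blast
  obtain \<tau>1 where \<tau>1: "bij \<tau>1" "\<And>v. v \<notin> S \<Longrightarrow> \<sigma> v = \<tau>1 v" "\<tau>1 y1 = u"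
    using place[OF assms(3,6,9)] by blast
  have im1: "\<tau>1 ` S = \<sigma> ` S" using bij_image_eq assms(3) \<tau>1 by metis
  obtain \<tau>2 where \<tau>2: "bij \<tau>2" "\<And>v. v \<notin> S \<Longrightarrow> \<tau>1 v = \<tau>2 v" "\<tau>2 w = x"
      "\<And>v. v \<noteq> w \<Longrightarrow> \<tau>1 v \<noteq> x \<Longrightarrow> \<tau>2 v = \<tau>1 v"
    using place[OF \<tau>1(1) assms(5), of x] xy im1 by metis
  have im2: "\<tau>2 ` S = \<sigma> ` S" using bij_image_eq \<tau>1 \<tau>2 im1 by metis
  obtain \<tau> where \<tau>: "bij \<tau>" "\<And>v. v \<notin> S \<Longrightarrow> \<tau>2 v = \<tau> v" "\<tau> y2 = y"
      "\<And>v. v \<noteq> y2 \<Longrightarrow> \<tau>2 v \<noteq> y \<Longrightarrow> \<tau> v = \<tau>2 v"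
    using place[OF \<tau>2(1) assms(7), of y] xy im2 by metis
  have ne: "u \<noteq> x" "u \<noteq> y" using xy by auto
  have 1: "\<tau>2 y1 = u" using \<tau>2(4)[of y1] \<tau>1(3) ne assms(8) by auto
  have 2: "\<tau> y1 = u" using \<tau>(4)[of y1] 1 ne assms(8) by auto
  have 3: "\<tau> w = x" using \<tau>(4)[of w] \<tau>2(3) xy assms(8) by auto
  have "reach S \<sigma> \<tau> \<or> reach S \<sigma> (transpose x y \<circ> \<tau>)"
    by (rule fullD[OF assms(1,3) \<tau>(1) _ assms(4)]) (use xy \<tau>1(2) \<tau>2(2) \<tau>(2) in auto)
  then show ?thesis
  proof
    assume "reach S \<sigma> \<tau>"
    then show ?thesis by (rule that) (use 2 3 \<tau>(3) xy in auto)
  next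
    assume "reach S \<sigma> (transpose x y \<circ> \<tau>)"
    then show ?thesis by (rule that) (use 2 3 \<tau>(3) xy in \<open>auto simp: Transposition.transpose_def\<close>)
  qed
qed

text \<open>
  If a person \<open>u\<close> can be brought to the new vertex \<open>v\<close> from everywhere, only the arrangement of
  the others on \<open>S\<close> is left to be compared.
\<close>
lemma full_insertI:
  assumes "full S c" "bij \<sigma>" "bij \<tau>" "\<And>t. t \<notin> insert v S \<Longrightarrow> \<sigma> t = \<tau> t" "v \<notin> S"
    "x \<in> \<sigma> ` insert v S" "y \<in> \<sigma> ` insert v S" "x \<noteq> y" "col x = col y"
    and \<sigma>': "reach (insert v S) \<sigma> \<sigma>'" "\<sigma>' v = u"
    and \<tau>': "reach (insert v S) \<tau> \<tau>'" "\<tau>' v = u"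
    and "u \<noteq> x" "u \<noteq> y" "\<And>k. c \<le> cnt S \<sigma>' k"
  shows "reach (insert v S) \<sigma> \<tau> \<or> reach (insert v S) \<sigma> (transpose x y \<circ> \<tau>)"
proof (rule reach_via[OF \<sigma>'(1) \<tau>'(1) assms(9)])
  have im: "\<sigma>' ` insert v S = \<sigma> ` insert v S"
    using reach_image[OF \<sigma>'(1) assms(2)] .
  have "reach S \<sigma>' \<tau>' \<or> reach S \<sigma>' (transpose x y \<circ> \<tau>')"
  proof (rule fullD[OF assms(1) _ _ _ assms(16)])
    show "bij \<sigma>'" "bij \<tau>'" using reach_bij \<sigma>' \<tau>' assms(2,3) by blast+
    show "\<sigma>' t = \<tau>' t" if "t \<notin> S" for t
      using reach_outside[OF \<sigma>'(1), of t] reach_outside[OF \<tau>'(1), of t] assms(4)[of t] \<sigma>' \<tau>' that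
      by (cases "t = v") auto
    show "x \<in> \<sigma>' ` S" "y \<in> \<sigma>' ` S" using assms(6,7,14,15) \<sigma>'(2) unfolding im[symmetric] by auto
  qed (use assms in auto)
  then show "reach (insert v S) \<sigma>' \<tau>' \<or> reach (insert v S) \<sigma>' (transpose x y \<circ> \<tau>')"
    using reach_mono[of S _ _ "insert v S"] by blast
qed

section \<open>Attaching a pendant vertex\<close>

lemma bring_pendant_other_colour:
  assumes "full S c" "2 \<le> c" "bij \<sigma>" "\<And>k. c \<le> cnt S \<sigma> k" "w \<in> S" "E v w" "v \<notin> S"
    "u \<in> \<sigma> ` S" "col u \<noteq> col (\<sigma> v)"
  obtains \<tau> where "reach (insert v S) \<sigma> \<tau>" "\<tau> v = u"
proof -
  obtain \<tau> where \<tau>: "reach S \<sigma> \<tau>" "\<tau> w = u" using bring[OF assms(1-5,8)] by blast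
  have v: "\<tau> v = \<sigma> v" using reach_outside[OF \<tau>(1)] assms(7) by blast
  have "reach (insert v S) \<tau> (\<tau> \<circ> transpose v w)"
    by (rule reach_swap) (use assms v \<tau> in auto)
  moreover have "reach (insert v S) \<sigma> \<tau>" using \<tau>(1) reach_mono by blast
  ultimately have "reach (insert v S) \<sigma> (\<tau> \<circ> transpose v w)" by (rule rtranclp_trans[rotated])
  then show ?thesis by (rule that) (use \<tau>(2) in simp)
qed

text \<open>The place \<open>v\<close> exchanges only with people of the other colour, so if
  \<open>u\<close> has the colour already on \<open>v\<close>, an intermediate \<open>t\<close> is
  needed. The bound \<open>Suc c\<close> guarantees \<open>c\<close> people of each colour on
  \<open>S\<close> whoever stands on \<open>v\<close>; this is the unit that a pendant vertex
  costs.\<close>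

lemma bring_pendant:
  assumes "full S c" "2 \<le> c" "finite S" "bij \<sigma>" "\<And>k. Suc c \<le> cnt (insert v S) \<sigma> k"
    "w \<in> S" "E v w" "v \<notin> S" "u \<in> \<sigma> ` insert v S"
  obtains \<tau> where "reach (insert v S) \<sigma> \<tau>" "\<tau> v = u"
proof (cases "\<sigma> v = u")
  case True
  then show ?thesis using that by blast
next
  case False
  then have u: "u \<in> \<sigma> ` S" using assms(9) by auto
  have c: "c \<le> cnt S \<sigma> k" for k
    using assms(5)[of k] cnt_insert[OF assms(3,8), of \<sigma> k] by (auto split: if_splits)
  show ?thesis
  proof (cases "col u = col (\<sigma> v)")
    case False
    then show ?thesis using bring_pendant_other_colour[OF assms(1,2,4) c assms(6-8) u] that by blast
  next
    case True
    have "1 \<le> cnt S \<sigma> (\<not> col u)" using c[of "\<not> col u"] assms(2) by linarith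
    then obtain t where t: "t \<in> \<sigma> ` S" "col t = (\<not> col u)"
      using ex_cnt assms(4) by blast
    obtain \<tau> where \<tau>: "reach (insert v S) \<sigma> \<tau>" "\<tau> v = t"
      using bring_pendant_other_colour[OF assms(1,2,4) c assms(6-8) t(1)] t True by auto
    have b: "bij \<tau>" using reach_bij \<tau>(1) assms(4) by blast
    have u': "u \<in> \<tau> ` S"
      using assms(9) \<tau>(2) t unfolding reach_image[OF \<tau>(1) assms(4), symmetric] by auto
    have "Suc c \<le> cnt (insert v S) \<tau> k" for k
      using assms(5) reach_cnt[OF \<tau>(1) assms(4)] by simp
    then have c': "c \<le> cnt S \<tau> k" for k
      using cnt_insert[OF assms(3,8), of \<tau> k] by (metis Suc_le_mono Suc_leD)
    obtain \<upsilon> where "reach (insert v S) \<tau> \<upsilon>" "\<upsilon> v = u"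
      using bring_pendant_other_colour[OF assms(1,2) b c' assms(6-8) u'] \<tau>(2) t by auto
    then show ?thesis by (intro that[of \<upsilon>] rtranclp_trans[OF \<tau>(1)])
  qed
qed

lemma full_insert_pendant:
  assumes "full S c" "2 \<le> c" "finite S" "w \<in> S" "E v w" "v \<notin> S"
  shows "full (insert v S) (Suc c)"
  unfolding full_def
proof (intro allI impI)
  fix \<sigma> \<tau> x y
  assume h: "bij \<sigma>" "bij \<tau>" "\<forall>t. t \<notin> insert v S \<longrightarrow> \<sigma> t = \<tau> t" "\<forall>k. Suc c \<le> cnt (insert v S) \<sigma> k"
    "x \<in> \<sigma> ` insert v S" "y \<in> \<sigma> ` insert v S" "x \<noteq> y" "col x = col y"
  have im: "\<sigma> ` insert v S = \<tau> ` insert v S" using bij_image_eq h by metis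
  have ct: "Suc c \<le> cnt (insert v S) \<tau> k" for k
    using h(4) im cnt_alt h(1,2) by metis
  \<comment> \<open>With \<open>u\<close> of the colour opposite to \<open>x\<close> and
    \<open>y\<close>, parking \<open>u\<close> on \<open>v\<close> keeps both of them on
    \<open>S\<close>, as the comparison there requires.\<close>
  have "1 \<le> cnt (insert v S) \<sigma> (\<not> col x)" using h(4)[rule_format, of "\<not> col x"] by linarith
  then obtain u where u: "u \<in> \<sigma> ` insert v S" "col u = (\<not> col x)" using ex_cnt h(1) by blast
  obtain \<sigma>' where \<sigma>': "reach (insert v S) \<sigma> \<sigma>'" "\<sigma>' v = u"
    using bring_pendant[OF assms(1-3) h(1) _ assms(4-6) u(1)] h(4) by blast
  obtain \<tau>' where \<tau>': "reach (insert v S) \<tau> \<tau>'" "\<tau>' v = u"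
    using bring_pendant[OF assms(1-3) h(2) ct assms(4-6)] u(1) im by metis
  have c': "c \<le> cnt S \<sigma>' k" for k
    using h(4) reach_cnt[OF \<sigma>'(1) h(1)] cnt_insert[OF assms(3,6), of \<sigma>' k]
    by (metis Suc_le_mono Suc_leD)
  show "reach (insert v S) \<sigma> \<tau> \<or> reach (insert v S) \<sigma> (transpose x y \<circ> \<tau>)"
    by (rule full_insertI[OF assms(1) h(1,2) _ assms(6) h(5-8) \<sigma>' \<tau>' _ _ c']) (use h u in auto)
qed

section \<open>The star with three leaves\<close>

text \<open>One swap takes \<open>u\<close> from its leaf to the centre if the colours differ.
  Otherwise the centre is first exchanged with a leaf of the other colour, which leaves
  \<open>u\<close> in place.\<close>

lemma star_bring_centre:
  assumes "bij \<sigma>" "\<And>k. 2 \<le> cnt (insert z P) \<sigma> k" "z \<notin> P" "\<And>p. p \<in> P \<Longrightarrow> E z p"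
    "u \<in> \<sigma> ` insert z P"
  obtains \<tau> where "reach (insert z P) \<sigma> \<tau>" "\<tau> z = u"
proof (cases "\<sigma> z = u")
  case True
  then show ?thesis using that by blast
next
  case False
  then obtain p where p: "p \<in> P" "\<sigma> p = u" using assms(5) by auto
  note result = that
  have diff: thesis if "bij \<rho>" "reach (insert z P) \<sigma> \<rho>" "col (\<rho> z) \<noteq> col u" "\<rho> p = u" for \<rho>
  proof (rule result)
    have "reach (insert z P) \<rho> (\<rho> \<circ> transpose z p)"
      by (rule reach_swap) (use p that assms(4) in auto)
    then show "reach (insert z P) \<sigma> (\<rho> \<circ> transpose z p)" using that(2) by (rule rtranclp_trans[rotated])
    show "(\<rho> \<circ> transpose z p) z = u" using \<open>\<rho> p = u\<close> by simp
  qed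
  show ?thesis
  proof (cases "col (\<sigma> z) = col u")
    case False
    then show ?thesis using diff[of \<sigma>] assms(1) p by blast
  next
    case True
    have "1 \<le> cnt (insert z P) \<sigma> (\<not> col u)" using assms(2)[of "\<not> col u"] by linarith
    then obtain t where "t \<in> \<sigma> ` insert z P" "col t = (\<not> col u)" using ex_cnt assms(1) by blast
    then obtain q where q: "q \<in> P" "col (\<sigma> q) \<noteq> col u" using True by auto
    have "reach (insert z P) \<sigma> (\<sigma> \<circ> transpose z q)"
      by (rule reach_swap) (use q True assms(4) in auto)
    moreover have "(\<sigma> \<circ> transpose z q) p = u"
      using q p assms(3) by (metis comp_apply transpose_apply_other)
    ultimately show ?thesis
      using diff[of "\<sigma> \<circ> transpose z q"] q(2) reach_bij[OF _ assms(1)] by simp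
  qed
qed

text \<open>
  With the swaps along \<open>zp\<close>, \<open>zq\<close>, \<open>zs\<close>, \<open>zp\<close> the occupant of the centre walks once around a
  4-cycle of the graph of people.
\<close>
lemma star_rotate:
  assumes "distinct [z, p, q, s]" "E z p" "E z q" "E z s"
    "col (\<sigma> q) = col (\<sigma> z)" "col (\<sigma> p) \<noteq> col (\<sigma> z)" "col (\<sigma> s) \<noteq> col (\<sigma> z)"
  shows "reach {z, p, q, s} \<sigma> (\<sigma>(p := \<sigma> s, q := \<sigma> p, s := \<sigma> q))"
proof -
  let ?S = "{z, p, q, s}"
  define \<sigma>1 where "\<sigma>1 = \<sigma> \<circ> transpose z p"
  define \<sigma>2 where "\<sigma>2 = \<sigma>1 \<circ> transpose z q"
  define \<sigma>3 where "\<sigma>3 = \<sigma>2 \<circ> transpose z s"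
  define \<sigma>4 where "\<sigma>4 = \<sigma>3 \<circ> transpose z p"
  note defs = \<sigma>1_def \<sigma>2_def \<sigma>3_def \<sigma>4_def
  have "reach ?S \<sigma> \<sigma>1" unfolding \<sigma>1_def by (rule reach_swap) (use assms in auto)
  also have "reach ?S \<sigma>1 \<sigma>2" unfolding \<sigma>2_def
    by (rule reach_swap) (use assms in \<open>auto simp: defs Transposition.transpose_def\<close>)
  also have "reach ?S \<sigma>2 \<sigma>3" unfolding \<sigma>3_def
    by (rule reach_swap) (use assms in \<open>auto simp: defs Transposition.transpose_def\<close>)
  also have "reach ?S \<sigma>3 \<sigma>4" unfolding \<sigma>4_def
    by (rule reach_swap) (use assms in \<open>auto simp: defs Transposition.transpose_def\<close>)
  also have "\<sigma>4 = \<sigma>(p := \<sigma> s, q := \<sigma> p, s := \<sigma> q)"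
    using assms(1) by (auto simp: defs Transposition.transpose_def fun_eq_iff)
  finally show ?thesis .
qed

text \<open>Four places carry exactly two people of each colour, so one leaf has the colour of the
  centre and the other two hold \<open>x\<close> and \<open>y\<close>. A rotation brings the
  occupant of that one leaf to \<open>q\<close>.\<close>

lemma star_normalise:
  assumes "distinct [z, p, q, s]" "E z p" "E z q" "E z s" "bij \<sigma>" "\<And>k. 2 \<le> cnt {z, p, q, s} \<sigma> k"
    "col (\<sigma> z) \<noteq> col x" "x \<noteq> y" "col x = col y" "x \<in> \<sigma> ` {z, p, q, s}" "y \<in> \<sigma> ` {z, p, q, s}"
  obtains \<tau> where "reach {z, p, q, s} \<sigma> \<tau>" "\<tau> z = \<sigma> z" "{\<tau> p, \<tau> s} = {x, y}"
proof -
  let ?S = "{z, p, q, s}"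
  have c: "card {t \<in> ?S. col (\<sigma> t) = k} \<ge> 2" for k using assms(6) unfolding cnt_def by blast
  have rest: "col (\<sigma> c) = col (\<sigma> z)"
    if "{x, y} = {\<sigma> a, \<sigma> b}" "{z, p, q, s} = {z, a, b, c}" for a b c
  proof (rule ccontr)
    assume "col (\<sigma> c) \<noteq> col (\<sigma> z)"
    moreover have "col (\<sigma> a) \<noteq> col (\<sigma> z)" "col (\<sigma> b) \<noteq> col (\<sigma> z)"
      using that(1) assms(7,9) by (metis insert_iff singletonD)+
    ultimately have "{t \<in> ?S. col (\<sigma> t) = col (\<sigma> z)} \<subseteq> {z}" unfolding that(2) by blast
    then have "card {t \<in> ?S. col (\<sigma> t) = col (\<sigma> z)} \<le> card {z}" by (intro card_mono) auto
    then show False using c[of "col (\<sigma> z)"] by simp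
  qed
  have xy: "x \<in> {\<sigma> p, \<sigma> q, \<sigma> s}" "y \<in> {\<sigma> p, \<sigma> q, \<sigma> s}" using assms(7,9-11) by auto
  then consider "{x, y} = {\<sigma> p, \<sigma> s}" | "{x, y} = {\<sigma> p, \<sigma> q}" | "{x, y} = {\<sigma> q, \<sigma> s}"
    using assms(8) by (metis doubleton_eq_iff insertE singletonD)
  then show ?thesis
  proof cases
    case 1
    then show ?thesis using that[of \<sigma>] by auto
  next
    case 2
    have s: "col (\<sigma> s) = col (\<sigma> z)" by (rule rest[OF 2]) auto
    have c2: "col (\<sigma> p) \<noteq> col (\<sigma> z)" "col (\<sigma> q) \<noteq> col (\<sigma> z)"
      using 2 assms(7,9) by (metis insert_iff singletonD)+
    have "reach {z, p, s, q} \<sigma> (\<sigma>(p := \<sigma> q, s := \<sigma> p, q := \<sigma> s))"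
      by (rule star_rotate) (use assms(1-4) s c2 in auto)
    moreover have "{z, p, s, q} = ?S" by auto
    ultimately have "reach ?S \<sigma> (\<sigma>(p := \<sigma> q, s := \<sigma> p, q := \<sigma> s))" by simp
    then show ?thesis by (rule that) (use 2 assms(1) in auto)
  next
    case 3
    have s: "col (\<sigma> p) = col (\<sigma> z)" by (rule rest[OF 3]) auto
    have c2: "col (\<sigma> q) \<noteq> col (\<sigma> z)" "col (\<sigma> s) \<noteq> col (\<sigma> z)"
      using 3 assms(7,9) by (metis insert_iff singletonD)+
    have "reach {z, s, p, q} \<sigma> (\<sigma>(s := \<sigma> q, p := \<sigma> s, q := \<sigma> p))"
      by (rule star_rotate) (use assms(1-4) s c2 in auto)
    moreover have "{z, s, p, q} = ?S" by auto
    ultimately have "reach ?S \<sigma> (\<sigma>(s := \<sigma> q, p := \<sigma> s, q := \<sigma> p))" by simp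
    then show ?thesis by (rule that) (use 3 assms(1) in auto)
  qed
qed

text \<open>After both arrangements are normalised to the same person at the centre and to
  \<open>x\<close>, \<open>y\<close> on the leaves \<open>p\<close>, \<open>s\<close>, only the
  order of \<open>x\<close> and \<open>y\<close> is open, and its two possibilities are the two
  outcomes allowed by \<open>full\<close>.\<close>

lemma full_star:
  assumes "distinct [z, p, q, s]" "E z p" "E z q" "E z s"
  shows "full {z, p, q, s} 2"
  unfolding full_def
proof (intro allI impI)
  let ?S = "{z, p, q, s}"
  fix \<sigma> \<tau> x y
  assume h: "bij \<sigma>" "bij \<tau>" "\<forall>t. t \<notin> ?S \<longrightarrow> \<sigma> t = \<tau> t" "\<forall>k. 2 \<le> cnt ?S \<sigma> k"
    "x \<in> \<sigma> ` ?S" "y \<in> \<sigma> ` ?S" "x \<noteq> y" "col x = col y"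
  have im: "\<sigma> ` ?S = \<tau> ` ?S" using bij_image_eq h(1-3) by blast
  have "1 \<le> cnt ?S \<sigma> (\<not> col x)" using h(4)[rule_format, of "\<not> col x"] by linarith
  then obtain u where u: "u \<in> \<sigma> ` ?S" "col u = (\<not> col x)" using ex_cnt h(1) by blast
  have norm: "\<exists>\<rho>'. reach ?S \<rho> \<rho>' \<and> \<rho>' z = u \<and> {\<rho>' p, \<rho>' s} = {x, y}"
    if \<rho>: "bij \<rho>" "\<rho> ` ?S = \<sigma> ` ?S" for \<rho>
  proof -
    have c: "2 \<le> cnt ?S \<rho> k" for k using h(4) cnt_alt[OF h(1)] cnt_alt[OF \<rho>(1)] \<rho>(2) by simp
    have "u \<in> \<rho> ` ?S" using \<rho>(2) u(1) by blast
    then obtain \<rho>1 where \<rho>1: "reach ?S \<rho> \<rho>1" "\<rho>1 z = u"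
      using star_bring_centre[OF \<rho>(1), of z "{p, q, s}" u] c assms by auto
    have b1: "bij \<rho>1" using reach_bij[OF \<rho>1(1) \<rho>(1)] .
    have im1: "\<rho>1 ` ?S = \<sigma> ` ?S" using reach_image[OF \<rho>1(1) \<rho>(1)] \<rho>(2) by (rule trans)
    have c1: "2 \<le> cnt ?S \<rho>1 k" for k using reach_cnt[OF \<rho>1(1) \<rho>(1)] c by simp
    have "col (\<rho>1 z) \<noteq> col x" using \<rho>1(2) u(2) by simp
    moreover have "x \<in> \<rho>1 ` ?S" "y \<in> \<rho>1 ` ?S" using im1 h(5,6) by blast+
    ultimately obtain \<rho>2 where "reach ?S \<rho>1 \<rho>2" "\<rho>2 z = \<rho>1 z" "{\<rho>2 p, \<rho>2 s} = {x, y}"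
      using star_normalise[OF assms b1 c1 _ h(7,8)] by blast
    then show ?thesis using \<rho>1 by (meson rtranclp_trans)
  qed
  obtain \<sigma>' where \<sigma>': "reach ?S \<sigma> \<sigma>'" "\<sigma>' z = u" "{\<sigma>' p, \<sigma>' s} = {x, y}"
    using norm[OF h(1)] by blast
  obtain \<tau>' where \<tau>': "reach ?S \<tau> \<tau>'" "\<tau>' z = u" "{\<tau>' p, \<tau>' s} = {x, y}"
    using norm[OF h(2)] im by auto
  have b: "bij \<sigma>'" "bij \<tau>'" using reach_bij \<sigma>'(1) \<tau>'(1) h(1,2) by blast+
  have out: "\<sigma>' t = \<tau>' t" if "t \<notin> ?S" for t
    using reach_outside[OF \<sigma>'(1) that] reach_outside[OF \<tau>'(1) that] h(3) that by metis
  have agree: "\<sigma>' t = \<tau>' t" if "t \<noteq> p" "t \<noteq> q" "t \<noteq> s" for t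
    using out[of t] that \<sigma>'(2) \<tau>'(2) by (cases "t = z") auto
  have q: "\<sigma>' q = \<tau>' q"
  proof -
    have im': "\<sigma>' ` (- {q}) = \<tau>' ` (- {q})"
    proof -
      have "- {q} = {p, s} \<union> - {p, q, s}" using assms(1) by auto
      moreover have "\<sigma>' ` (- {p, q, s}) = \<tau>' ` (- {p, q, s})" using agree by (intro image_cong) auto
      moreover have "\<sigma>' ` {p, s} = \<tau>' ` {p, s}" using \<sigma>'(3) \<tau>'(3) by simp
      ultimately show ?thesis by (metis image_Un)
    qed
    then have "- {\<sigma>' q} = - {\<tau>' q}"
      using bij_image_Compl_eq[OF b(1), of "{q}"] bij_image_Compl_eq[OF b(2), of "{q}"] by simp
    then show ?thesis by blast
  qed
  have "\<sigma>' = \<tau>' \<or> \<sigma>' = transpose x y \<circ> \<tau>'"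
  proof (cases "\<sigma>' p = \<tau>' p")
    case True
    then have "\<sigma>' s = \<tau>' s" using \<sigma>'(3) \<tau>'(3) by (metis doubleton_eq_iff)
    then show ?thesis using True q agree by (metis ext)
  next
    case False
    then have sw: "\<sigma>' p = \<tau>' s" "\<sigma>' s = \<tau>' p" using \<sigma>'(3) \<tau>'(3) by (metis doubleton_eq_iff)+
    have xy: "x = \<tau>' p \<and> y = \<tau>' s \<or> x = \<tau>' s \<and> y = \<tau>' p" using \<tau>'(3) by (metis doubleton_eq_iff)
    have "\<sigma>' t = transpose x y (\<tau>' t)" for t
    proof (cases "t = p \<or> t = s")
      case True
      then show ?thesis using xy sw by (auto simp: Transposition.transpose_def)
    next
      case False
      then have "\<tau>' t \<noteq> x" "\<tau>' t \<noteq> y" using xy bij_is_inj[OF b(2)] by (metis injD)+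
      moreover have "\<sigma>' t = \<tau>' t" using False q agree by metis
      ultimately show ?thesis by simp
    qed
    then show ?thesis by (auto simp: fun_eq_iff)
  qed
  then have "reach ?S \<sigma>' \<tau>' \<or> reach ?S \<sigma>' (transpose x y \<circ> \<tau>')" by auto
  then show "reach ?S \<sigma> \<tau> \<or> reach ?S \<sigma> (transpose x y \<circ> \<tau>)"
    by (rule reach_via[OF \<sigma>'(1) \<tau>'(1) h(8)])
qed

section \<open>Growing full sets\<close>

text \<open>Connectedness of the subgraph induced on \<open>S\<close>, in terms of cuts: growing
  \<open>S\<close> needs just one leaving edge, and the union bound over cuts delivers exactly this
  form.\<close>

definition conn :: "'a set \<Rightarrow> bool" where
  "conn S \<longleftrightarrow> (\<forall>A. A \<subseteq> S \<longrightarrow> A \<noteq> {} \<longrightarrow> A \<noteq> S \<longrightarrow> (\<exists>a\<in>A. \<exists>b\<in>S - A. E a b))"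

lemma connD: "conn S \<Longrightarrow> A \<subseteq> S \<Longrightarrow> A \<noteq> {} \<Longrightarrow> A \<noteq> S \<Longrightarrow> \<exists>a\<in>A. \<exists>b\<in>S - A. E a b"
  unfolding conn_def by blast

lemma conn_insert:
  assumes "conn S" "w \<in> S" "E w v"
  shows "conn (insert v S)"
  unfolding conn_def
proof (intro allI impI)
  fix A assume A: "A \<subseteq> insert v S" "A \<noteq> {}" "A \<noteq> insert v S"
  consider "A \<inter> S = {}" | "S \<subseteq> A" | "A \<inter> S \<noteq> {}" "A \<inter> S \<noteq> S" by blast
  then show "\<exists>a\<in>A. \<exists>b\<in>insert v S - A. E a b"
  proof cases
    case 1
    then have "v \<in> A" using A by blast
    then show ?thesis using 1 assms(2) sym[OF assms(3)] by blast
  next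
    case 2
    then have "v \<notin> A" using A by blast
    then show ?thesis using 2 assms(2,3) by blast
  next
    case 3
    then show ?thesis using connD[OF assms(1), of "A \<inter> S"] by blast
  qed
qed

section \<open>Attaching a vertex at a branching\<close>

text \<open>The set \<open>A\<close> of places from which colour \<open>k\<close> can be fetched is
  closed under adjacency: from a neighbour of \<open>A\<close> the colour enters \<open>A\<close> by
  one swap, unless it is there already. Only connectedness enters, so this also works when one
  colour is too rare on \<open>S\<close> for \<open>full\<close>.\<close>

lemma bring_colour:
  assumes "conn S" "w \<in> S" "t \<in> S" "col (\<sigma> t) = k"
  obtains \<tau> where "reach S \<sigma> \<tau>" "col (\<tau> w) = k"
proof -
  define A where "A = {t \<in> S. \<forall>\<sigma>. col (\<sigma> t) = k \<longrightarrow> (\<exists>\<tau>. reach S \<sigma> \<tau> \<and> col (\<tau> w) = k)}"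
  have "A = S"
  proof (rule ccontr)
    have "w \<in> A" using assms(2) unfolding A_def by blast
    moreover assume "A \<noteq> S"
    ultimately obtain a b where ab: "a \<in> A" "b \<in> S - A" "E a b"
      using connD[OF assms(1), of A] unfolding A_def by blast
    have "\<exists>\<tau>. reach S \<sigma> \<tau> \<and> col (\<tau> w) = k" if b: "col (\<sigma> b) = k" for \<sigma>
    proof (cases "col (\<sigma> a) = k")
      case True
      then show ?thesis using ab(1) unfolding A_def by blast
    next
      case False
      have "reach S \<sigma> (\<sigma> \<circ> transpose a b)"
        by (rule reach_swap) (use ab False b in \<open>auto simp: A_def\<close>)
      moreover have "col ((\<sigma> \<circ> transpose a b) a) = k" using b by simp
      ultimately show ?thesis using ab(1) unfolding A_def by (blast intro: rtranclp_trans)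
    qed
    then show False using ab(2) unfolding A_def by blast
  qed
  then show ?thesis using assms(3,4) that unfolding A_def by blast
qed

text \<open>
  The vertex \<open>w\<close> with its neighbours \<open>y1\<close>, \<open>y2\<close> serves as a turnout in which the person at \<open>v\<close>
  lets \<open>u\<close> overtake.
\<close>
lemma bring_branch:
  assumes "full S c" "2 \<le> c" "finite S" "bij \<sigma>" "\<And>k. c \<le> cnt (insert v S) \<sigma> k"
    "c < cnt (insert v S) \<sigma> (col u)" "conn S"
    "w \<in> S" "y1 \<in> S" "y2 \<in> S" "distinct [w, y1, y2]" "E v w" "E w y1" "E w y2" "v \<notin> S"
    "u \<in> \<sigma> ` insert v S"
  obtains \<tau> where "reach (insert v S) \<sigma> \<tau>" "\<tau> v = u" "\<And>k. c \<le> cnt S \<tau> k"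
proof -
  let ?T = "insert v S"
  note result = that
  \<comment> \<open>The colour of \<open>u\<close> occurs more than \<open>c\<close> times, so with
    one such person on \<open>v\<close> there remain \<open>c\<close> of each colour on
    \<open>S\<close>.\<close>
  have cS: "c \<le> cnt S \<rho> k" if "reach ?T \<sigma> \<rho>" "col (\<rho> v) = col u" for \<rho> k
  proof -
    have eq: "cnt ?T \<rho> l = cnt ?T \<sigma> l" for l using reach_cnt[OF that(1) assms(4)] .
    show ?thesis
      using cnt_insert[OF assms(3,15), of \<rho> k] that(2) assms(5)[of k] assms(6) eq[of k]
      by (cases "k = col u") auto
  qed
  have overtake: thesis if \<rho>: "reach ?T \<sigma> \<rho>" "col (\<rho> v) = col u" for \<rho>
  proof (cases "\<rho> v = u")
    case True
    then show ?thesis using result[OF \<rho>(1)] cS[OF \<rho>] by blast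
  next
    case False
    have b: "bij \<rho>" using reach_bij[OF \<rho>(1) assms(4)] .
    have "u \<in> \<rho> ` S" using assms(16) False reach_image[OF \<rho>(1) assms(4)] by (metis image_insert insertE)
    then obtain \<rho>0 where \<rho>0: "reach S \<rho> \<rho>0" "\<rho>0 y1 = u" "col (\<rho>0 w) \<noteq> col u" "col (\<rho>0 y2) \<noteq> col u"
      using bring3[OF assms(1,2) b cS[OF \<rho>] assms(8-11)] by blast
    have v: "col (\<rho>0 v) = col u" using reach_outside[OF \<rho>0(1) assms(15)] \<rho>(2) by simp
    have ne: "v \<noteq> w" "v \<noteq> y1" "v \<noteq> y2" using assms(8-10,15) by auto
    \<comment> \<open>The person on \<open>v\<close> enters \<open>w\<close> and steps aside to
      \<open>y2\<close>; then \<open>u\<close> passes from \<open>y1\<close> through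
      \<open>w\<close> to \<open>v\<close>. The colours in \<open>\<rho>0\<close> make all four
      swaps legal.\<close>
    define \<rho>1 where "\<rho>1 = \<rho>0 \<circ> transpose v w"
    define \<rho>2 where "\<rho>2 = \<rho>1 \<circ> transpose w y2"
    define \<rho>3 where "\<rho>3 = \<rho>2 \<circ> transpose w y1"
    define \<rho>4 where "\<rho>4 = \<rho>3 \<circ> transpose v w"
    note defs = \<rho>1_def \<rho>2_def \<rho>3_def \<rho>4_def
    have "reach ?T \<sigma> \<rho>0" using \<rho>(1) reach_mono[OF \<rho>0(1), of ?T] by (meson rtranclp_trans subset_insertI)
    also have "reach ?T \<rho>0 \<rho>1" unfolding \<rho>1_def
      by (rule reach_swap) (use assms(8-14) v \<rho>0 in auto)
    also have "reach ?T \<rho>1 \<rho>2" unfolding \<rho>2_def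
      by (rule reach_swap) (use assms(8-14) ne v \<rho>0 in \<open>auto simp: defs Transposition.transpose_def\<close>)
    also have "reach ?T \<rho>2 \<rho>3" unfolding \<rho>3_def
      by (rule reach_swap) (use assms(8-14) ne v \<rho>0 in \<open>auto simp: defs Transposition.transpose_def\<close>)
    also have "reach ?T \<rho>3 \<rho>4" unfolding \<rho>4_def
      by (rule reach_swap) (use assms(8-14) ne v \<rho>0 in \<open>auto simp: defs Transposition.transpose_def\<close>)
    finally have r: "reach ?T \<sigma> \<rho>4" .
    have "\<rho>4 v = u" using assms(11) ne \<rho>0(2) by (auto simp: defs Transposition.transpose_def)
    then show ?thesis using result[OF r] cS[OF r] by auto
  qed
  show ?thesis
  proof (cases "col (\<sigma> v) = col u")
    case True
    then show ?thesis using overtake[of \<sigma>] by blast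
  next
    case False
    \<comment> \<open>In this case \<open>S\<close> may hold only \<open>c - 1\<close> people of the
      colour on \<open>v\<close>, so \<open>full S c\<close> cannot be used yet;
      \<open>bring_colour\<close> first fetches somebody of the colour of \<open>u\<close>.\<close>
    have c: "c \<le> cnt S \<sigma> (col u)"
      using cnt_insert[OF assms(3,15), of \<sigma> "col u"] False assms(6) by simp
    then have "1 \<le> cnt S \<sigma> (col u)" using assms(2) by linarith
    then obtain t where "t \<in> S" "col (\<sigma> t) = col u" using ex_cnt[OF assms(4)] by (metis imageE)
    then obtain \<rho> where \<rho>: "reach S \<sigma> \<rho>" "col (\<rho> w) = col u"
      using bring_colour[OF assms(7,8)] by blast
    have "reach ?T \<rho> (\<rho> \<circ> transpose v w)"
      by (rule reach_swap)
        (use assms(8,12) \<rho>(2) False reach_outside[OF \<rho>(1) assms(15)] in auto)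
    then have "reach ?T \<sigma> (\<rho> \<circ> transpose v w)"
      using reach_mono[OF \<rho>(1) subset_insertI] by (rule rtranclp_trans[rotated])
    then show ?thesis by (rule overtake) (use \<rho>(2) in simp)
  qed
qed

text \<open>Among at least \<open>2 * c + 1\<close> people on \<open>insert v S\<close>, some colour
  occurs more than \<open>c\<close> times, and one of its people can be parked on \<open>v\<close>
  without loss. By \<open>2 \<le> c\<close> there are at least three of them, so one differs from
  \<open>x\<close> and \<open>y\<close>.\<close>

lemma full_insert_branch:
  assumes "full S c" "2 \<le> c" "2 * c \<le> card S" "finite S" "conn S"
    "w \<in> S" "y1 \<in> S" "y2 \<in> S" "distinct [w, y1, y2]" "E v w" "E w y1" "E w y2" "v \<notin> S"
  shows "full (insert v S) c"
  unfolding full_def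
proof (intro allI impI)
  let ?T = "insert v S"
  fix \<sigma> \<tau> x y
  assume h: "bij \<sigma>" "bij \<tau>" "\<forall>t. t \<notin> ?T \<longrightarrow> \<sigma> t = \<tau> t" "\<forall>k. c \<le> cnt ?T \<sigma> k"
    "x \<in> \<sigma> ` ?T" "y \<in> \<sigma> ` ?T" "x \<noteq> y" "col x = col y"
  have im: "\<sigma> ` ?T = \<tau> ` ?T" using bij_image_eq h(1-3) by blast
  have cnt_eq: "cnt ?T \<tau> k = cnt ?T \<sigma> k" for k
    unfolding cnt_alt[OF h(1)] cnt_alt[OF h(2)] im ..
  have "cnt ?T \<sigma> True + cnt ?T \<sigma> (\<not> True) = Suc (card S)"
    using cnt_sum[of ?T \<sigma> True] assms(4,13) by simp
  then have "\<exists>k. c < cnt ?T \<sigma> k" using assms(3) by (smt (verit) linorder_not_less add_mono not_less_eq_eq mult_2)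
  then obtain k where k: "c < cnt ?T \<sigma> k" ..
  have "3 \<le> card {x \<in> \<sigma> ` ?T. col x = k}" using k assms(2) unfolding cnt_alt[OF h(1)] by linarith
  moreover have "card {x, y} \<le> 2" by (simp add: card_insert_if)
  ultimately have "\<not> {x \<in> \<sigma> ` ?T. col x = k} \<subseteq> {x, y}"
    using card_mono[of "{x, y}" "{x \<in> \<sigma> ` ?T. col x = k}"] by fastforce
  then obtain u where u: "u \<in> \<sigma> ` ?T" "col u = k" "u \<noteq> x" "u \<noteq> y" by blast
  obtain \<sigma>' where \<sigma>': "reach ?T \<sigma> \<sigma>'" "\<sigma>' v = u" "\<And>k. c \<le> cnt S \<sigma>' k"
    using bring_branch[OF assms(1,2,4) h(1) _ _ assms(5-13) u(1)] h(4) k u(2) by blast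
  have "c \<le> cnt ?T \<tau> l" for l using h(4) cnt_eq by simp
  moreover have "c < cnt ?T \<tau> (col u)" using k u(2) cnt_eq by simp
  moreover have "u \<in> \<tau> ` ?T" using u(1) unfolding im .
  ultimately obtain \<tau>' where \<tau>': "reach ?T \<tau> \<tau>'" "\<tau>' v = u"
    using bring_branch[OF assms(1,2,4) h(2) _ _ assms(5-13), of u] by blast
  show "reach ?T \<sigma> \<tau> \<or> reach ?T \<sigma> (transpose x y \<circ> \<tau>)"
    by (rule full_insertI[OF assms(1) h(1,2) _ assms(13) h(5-8) \<sigma>'(1,2) \<tau>' _ _ \<sigma>'(3)])
      (use h(3) u in auto)
qed

lemma full_mono: "full S c \<Longrightarrow> c \<le> d \<Longrightarrow> full S d"
  unfolding full_def by (meson order_trans)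

section \<open>Attaching whole neighbourhoods\<close>

definition core :: "'a set \<Rightarrow> nat \<Rightarrow> bool" where
  "core S c \<longleftrightarrow> full S c \<and> 2 \<le> c \<and> finite S \<and> conn S"

lemma core_insert_branch:
  assumes "core S c" "2 * c \<le> card S" "w \<in> S" "y1 \<in> S" "y2 \<in> S" "y1 \<noteq> y2" "E w y1" "E w y2" "E w v"
  shows "core (insert v S) c"
proof (cases "v \<in> S")
  case True
  then show ?thesis using assms(1) by (simp add: insert_absorb)
next
  case False
  have "distinct [w, y1, y2]" using assms(6-8) irrefl by auto
  then have "full (insert v S) c"
    using full_insert_branch[of S c w y1 y2 v] assms False sym unfolding core_def by blast
  then show ?thesis using assms conn_insert unfolding core_def by blast
qed

lemma core_Un_branch:
  assumes "finite N" "core S c" "2 * c \<le> card S" "w \<in> S" "y1 \<in> S" "y2 \<in> S" "y1 \<noteq> y2"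
    "E w y1" "E w y2" "\<And>v. v \<in> N \<Longrightarrow> E w v"
  shows "core (S \<union> N) c"
  using assms(1,10)
proof (induction N)
  case empty
  then show ?case using assms(2) by simp
next
  case (insert v N)
  then have c: "core (S \<union> N) c" by blast
  then have "card S \<le> card (S \<union> N)" unfolding core_def by (intro card_mono) auto
  then have "core (insert v (S \<union> N)) c"
    using assms(3-9) insert.prems by (intro core_insert_branch[OF c, of w y1 y2 v]) auto
  then show ?case by simp
qed

text \<open>Only the first new neighbour \<open>v\<close> costs a unit. After it, \<open>w\<close>
  has two neighbours in the set, namely \<open>v\<close> and one supplied by connectedness, so the
  others are attached at a branching. Strictness in \<open>2 * c < card S\<close>, together with
  \<open>v\<close>, restores the size condition for \<open>Suc c\<close>.\<close>

lemma core_process: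
  assumes "core S c" "2 * c < card S" "w \<in> S" "finite N" "\<And>v. v \<in> N \<Longrightarrow> E w v"
  shows "core (S \<union> N) (Suc c)"
proof (cases "N \<subseteq> S")
  case True
  then have "S \<union> N = S" by blast
  then show ?thesis using assms(1) full_mono[of S c "Suc c"] unfolding core_def by simp
next
  case False
  then obtain v where v: "v \<in> N" "v \<notin> S" by blast
  note S = assms(1)[unfolded core_def]
  have "S \<noteq> {w}" using assms(2) S by auto
  then obtain y where y: "y \<in> S" "E w y" using S connD[of S "{w}"] assms(3) by blast
  have "full (insert v S) (Suc c)"
    using full_insert_pendant[of S c w v] S assms(3,5) v sym by blast
  then have "core (insert v S) (Suc c)"
    using S conn_insert[of S w v] assms(3,5) v unfolding core_def by simp
  moreover have "2 * Suc c \<le> card (insert v S)" using assms(2) S v by simp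
  ultimately have "core (insert v S \<union> N) (Suc c)"
    using assms(3-5) v y by (intro core_Un_branch[where w = w and ?y1.0 = y and ?y2.0 = v]) auto
  then show ?thesis using v by (simp add: insert_absorb)
qed

lemma conn_star:
  assumes "finite P" "\<And>p. p \<in> P \<Longrightarrow> E z p"
  shows "conn (insert z P)"
  using assms
proof (induction P)
  case empty
  show ?case unfolding conn_def by blast
next
  case (insert p P)
  then have "conn (insert p (insert z P))" using conn_insert[of "insert z P" z p] by simp
  then show ?case by (simp add: insert_commute[of z p])
qed

lemma core_star:
  assumes "finite P" "4 \<le> card P" "\<And>p. p \<in> P \<Longrightarrow> E z p"
  shows "core (insert z P) 2"
proof -
  have "3 \<le> card P" using assms(2) by linarith
  then obtain Q where Q: "Q \<subseteq> P" "card Q = 3" by (rule obtain_subset_with_card_n)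
  from Q(2) obtain p q s where pqs: "Q = {p, q, s}" "p \<noteq> q" "q \<noteq> s" "p \<noteq> s"
    unfolding card_3_iff by (elim exE conjE)
  then have E: "E z p" "E z q" "E z s" using Q(1) assms(3) by blast+
  then have d: "distinct [z, p, q, s]" using pqs irrefl by auto
  have "conn {z, p, q, s}" using E by (intro conn_star) auto
  then have "core {z, p, q, s} 2" using full_star[OF d E] unfolding core_def by simp
  then have "core ({z, p, q, s} \<union> P) 2"
    by (rule core_Un_branch[OF assms(1), where w = z and ?y1.0 = p and ?y2.0 = q]) (use d E assms(3) in auto)
  moreover have "{z, p, q, s} \<union> P = insert z P" using Q(1) pqs(1) by blast
  ultimately show ?thesis by simp
qed

section \<open>Growth by expansion and by a dominating set\<close>

definition nbs :: "'a set \<Rightarrow> 'a set" where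
  "nbs S = {v. \<exists>s\<in>S. E s v}"

lemma mem_nbs: "v \<in> nbs S \<longleftrightarrow> (\<exists>s\<in>S. E s v)"
  unfolding nbs_def by simp

lemma grow_core:
  assumes "finite V" "\<And>a b. E a b \<Longrightarrow> b \<in> V" "V - B \<noteq> {}" "1 \<le> M"
    and expand: "\<And>S. S \<noteq> {} \<Longrightarrow> S \<subseteq> V - B \<Longrightarrow> card S \<le> M \<Longrightarrow> 3 * card S < card (nbs S - (B \<union> S))"
  obtains S c where "core S c" "S \<subseteq> V" "3 * c \<le> card S + 1" "M < card S"
proof -
  \<comment> \<open>Three vertices per unit; the \<open>+ 1\<close> is dictated by the start, a star
    with at least five vertices at cost two.\<close>
  define P where "P S \<longleftrightarrow> S \<subseteq> V - B \<and> (\<exists>c. core S c \<and> 3 * c \<le> card S + 1)" for S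
  obtain z where z: "z \<in> V - B" using assms(3) by blast
  let ?N = "nbs {z} - (B \<union> {z})"
  have fin: "finite (nbs S)" for S
    by (rule finite_subset[OF _ assms(1)]) (use assms(2) in \<open>auto simp: mem_nbs\<close>)
  have N: "4 \<le> card ?N" using expand[of "{z}"] z assms(4) by simp
  have "core (insert z ?N) 2"
    by (rule core_star) (use N fin in \<open>auto simp: mem_nbs\<close>)
  moreover have "card (insert z ?N) = Suc (card ?N)" using fin by simp
  moreover have "insert z ?N \<subseteq> V - B" using z assms(2) by (auto simp: mem_nbs)
  ultimately have "P (insert z ?N)" unfolding P_def using N by (intro conjI exI[of _ 2]) auto
  moreover have "\<forall>S. P S \<longrightarrow> card S < Suc (card V)"
    unfolding P_def less_Suc_eq_le using card_mono[OF assms(1)] by blast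
  ultimately have "\<exists>S. P S \<and> (\<forall>T. P T \<longrightarrow> card T \<le> card S)" by (rule Lattices_Big.ex_has_greatest_nat)
  then obtain S where "P S" and max: "\<And>T. P T \<Longrightarrow> card T \<le> card S" by blast
  then obtain c where S: "S \<subseteq> V - B" and c: "core S c" "3 * c \<le> card S + 1" unfolding P_def by blast
  have fS: "finite S" and c2: "2 \<le> c" using c(1) unfolding core_def by auto
  have "M < card S"
  proof (rule ccontr)
    assume "\<not> M < card S"
    moreover have "S \<noteq> {}" using c(2) c2 by auto
    ultimately have e: "3 * card S < card (nbs S - (B \<union> S))" using S by (intro expand) auto
    \<comment> \<open>Averaging: with at most two new neighbours for each vertex, \<open>S\<close>
      would have at most \<open>2 * card S\<close> of them.\<close>
    have "\<exists>w\<in>S. 3 \<le> card (nbs {w} - (B \<union> S))"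
    proof (rule ccontr)
      assume "\<not> ?thesis"
      then have "card (nbs {w} - (B \<union> S)) \<le> 2" if "w \<in> S" for w using that by force
      then have "(\<Sum>w\<in>S. card (nbs {w} - (B \<union> S))) \<le> (\<Sum>w\<in>S. 2)" by (intro sum_mono)
      moreover have "nbs S - (B \<union> S) = (\<Union>w\<in>S. nbs {w} - (B \<union> S))" by (auto simp: mem_nbs)
      ultimately have "card (nbs S - (B \<union> S)) \<le> card S * 2"
        using card_UN_le[OF fS, of "\<lambda>w. nbs {w} - (B \<union> S)"] by simp
      then show False using e by simp
    qed
    then obtain w where w: "w \<in> S" "3 \<le> card (nbs {w} - (B \<union> S))" by blast
    let ?N = "nbs {w} - (B \<union> S)"
    have "core (S \<union> ?N) (Suc c)"
      by (rule core_process[OF c(1) _ w(1)]) (use c(2) c2 fin in \<open>auto simp: mem_nbs\<close>)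
    moreover have "card (S \<union> ?N) = card S + card ?N"
      using fS fin by (intro card_Un_disjoint) auto
    moreover have "S \<union> ?N \<subseteq> V - B" using S assms(2) by (auto simp: mem_nbs)
    ultimately have "P (S \<union> ?N)" unfolding P_def using c(2) w(2) by (intro conjI exI[of _ "Suc c"]) auto
    from max[OF this] show False using \<open>card (S \<union> ?N) = _\<close> w(2) by simp
  qed
  then show ?thesis using that c S by blast
qed

text \<open>If \<open>S\<close> is not everything, some edge leads from \<open>w\<close> in
  \<open>S\<close> to \<open>v\<close> outside, and \<open>v\<close> is in the closed neighbourhood
  of some \<open>d\<close> in \<open>D\<close>. Processing \<open>w\<close>, \<open>v\<close> and
  \<open>d\<close> in turn costs three units and absorbs this whole neighbourhood. Each round thus
  finishes a new member of \<open>D\<close>, and the bound on the total cost persists.\<close>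

lemma full_of_dominating_set:
  assumes "finite V" "\<And>a b. E a b \<Longrightarrow> b \<in> V" "conn V"
    and D: "finite D" "\<And>v. v \<in> V \<Longrightarrow> v \<in> D \<or> (\<exists>d\<in>D. E d v)"
    and S: "core S c" "S \<subseteq> V" "2 * (c + 3 * card {d \<in> D. \<not> insert d (nbs {d}) \<subseteq> S}) < card S"
  shows "full V (c + 3 * card {d \<in> D. \<not> insert d (nbs {d}) \<subseteq> S})"
  using S
proof (induction "card {d \<in> D. \<not> insert d (nbs {d}) \<subseteq> S}" arbitrary: S c rule: less_induct)
  case less
  let ?U = "\<lambda>S. {d \<in> D. \<not> insert d (nbs {d}) \<subseteq> S}"
  have arith: "2 * (Suc (Suc (Suc c)) + 3 * k') < t"
    if "k' < k" "2 * (c + 3 * k) < s" "s \<le> t" for k k' s t :: nat using that by presburger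
  have fin: "finite (nbs S)" for S
    by (rule finite_subset[OF _ assms(1)]) (use assms(2) in \<open>auto simp: mem_nbs\<close>)
  have nV: "nbs S \<subseteq> V" for S using assms(2) by (auto simp: mem_nbs)
  show ?case
  proof (cases "S = V")
    case True
    then have "full V c" using less.prems(1) unfolding core_def by blast
    then show ?thesis by (rule full_mono) simp
  next
    case False
    have "S \<noteq> {}" using less.prems(3) by auto
    then obtain w v where wv: "w \<in> S" "v \<in> V - S" "E w v"
      using connD[OF assms(3) less.prems(2)] False by blast
    obtain d where d: "d \<in> D" "v \<in> insert d (nbs {d})"
      using D(2)[of v] wv(2) by (auto simp: mem_nbs)
    define S1 where "S1 = S \<union> nbs {w}"
    define S2 where "S2 = S1 \<union> nbs {v}"
    define S3 where "S3 = S2 \<union> nbs {d}"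
    have fS: "finite S" using less.prems(2) assms(1) finite_subset by blast
    have vU: "d \<in> ?U S" using d wv(2) by auto
    then have "?U S \<noteq> {}" by blast
    then have U: "0 < card (?U S)" using D(1) by (simp add: card_gt_0_iff)
    have mem: "v \<in> S1" "d \<in> S2"
      using wv(3) d(2) sym unfolding S1_def S2_def nbs_def by auto
    have sub: "S \<subseteq> S1" "S1 \<subseteq> S2" "S2 \<subseteq> S3" unfolding S1_def S2_def S3_def by auto
    have f: "finite S1" "finite S2" "finite S3" unfolding S1_def S2_def S3_def using fS fin by auto
    have le: "card S \<le> card S1" "card S1 \<le> card S2" "card S2 \<le> card S3"
      using sub f by (auto intro: card_mono)
    have "core S1 (Suc c)" unfolding S1_def
      by (rule core_process[OF less.prems(1)]) (use less.prems(3) wv fin in \<open>auto simp: mem_nbs\<close>)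
    then have "core S2 (Suc (Suc c))" unfolding S2_def
      by (rule core_process) (use less.prems(3) U le mem fin in \<open>auto simp: mem_nbs\<close>)
    then have core: "core S3 (Suc (Suc (Suc c)))" unfolding S3_def
      by (rule core_process) (use less.prems(3) U le mem fin in \<open>auto simp: mem_nbs\<close>)
    have "insert d (nbs {d}) \<subseteq> S3" using mem sub unfolding S3_def by auto
    then have "?U S3 \<subset> ?U S" using sub vU by blast
    then have lt: "card (?U S3) < card (?U S)" using D(1) by (intro psubset_card_mono) auto
    have "S3 \<subseteq> V" unfolding S1_def S2_def S3_def using less.prems(2) nV by auto
    moreover have "2 * (Suc (Suc (Suc c)) + 3 * card (?U S3)) < card S3"
      by (rule arith[OF lt less.prems(3)]) (use le in linarith)
    ultimately have "full V (Suc (Suc (Suc c)) + 3 * card (?U S3))"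
      using less.hyps[OF lt core] by blast
    then show ?thesis by (rule full_mono) (use lt in simp)
  qed
qed

lemma card_missed_less:
  assumes "\<And>A B. A \<subseteq> L \<Longrightarrow> B \<subseteq> R \<Longrightarrow> card A = m \<Longrightarrow> card B = m \<Longrightarrow> \<exists>a\<in>A. \<exists>b\<in>B. E a b"
    and "A \<subseteq> L" "m \<le> card A"
  shows "card (R - nbs A) < m"
proof (rule ccontr)
  assume "\<not> ?thesis"
  then have "m \<le> card (R - nbs A)" by simp
  then obtain B where B: "B \<subseteq> R - nbs A" "card B = m" by (rule obtain_subset_with_card_n)
  from assms(3) obtain A' where A': "A' \<subseteq> A" "card A' = m" by (rule obtain_subset_with_card_n)
  have "\<exists>a\<in>A'. \<exists>b\<in>B. E a b" by (rule assms(1)) (use A' B assms(2) in auto)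
  then show False using A'(1) B(1) unfolding nbs_def by blast
qed

text \<open>
  Outside a maximal small set \<open>B\<close> with few neighbours all small sets expand, because a set that is
  not small has neighbours almost everywhere.
\<close>
lemma full_of_connected_no_holes:
  assumes fin: "finite L" "finite R" and disj: "L \<inter> R = {}" and card: "card L = r" "card R = r"
    and bip: "\<And>a b. E a b \<Longrightarrow> a \<in> L \<and> b \<in> R \<or> a \<in> R \<and> b \<in> L"
    and con: "conn (L \<union> R)"
    and holes: "\<And>A B. A \<subseteq> L \<Longrightarrow> B \<subseteq> R \<Longrightarrow> card A = m \<Longrightarrow> card B = m \<Longrightarrow> \<exists>a\<in>A. \<exists>b\<in>B. E a b"
    and m: "1 \<le> m" "700 * m \<le> r"
  shows "full (L \<union> R) r"
proof -
  let ?V = "L \<union> R"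
  have fV: "finite ?V" using fin by simp
  have inV: "\<And>a b. E a b \<Longrightarrow> b \<in> ?V" using bip by blast
  have holes': "\<exists>a\<in>A. \<exists>b\<in>B. E a b" if "A \<subseteq> R" "B \<subseteq> L" "card A = m" "card B = m" for A B
    using holes[of B A] that sym by blast
  have fn: "finite (nbs S)" for S
    by (rule finite_subset[OF _ fV]) (use inV in \<open>unfold nbs_def, blast\<close>)
  have cV: "card ?V = 2 * r" using card_Un_disjoint[OF fin disj] card by simp
  have missed: "card (R - nbs A) < m" if "A \<subseteq> L" "m \<le> card A" for A
    using card_missed_less[OF holes that] .
  have missed': "card (L - nbs A) < m" if "A \<subseteq> R" "m \<le> card A" for A
    using card_missed_less[OF holes' that] .
  \<comment> \<open>\<open>T\<close> has at least \<open>m\<close> vertices on one side, whose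
    neighbours miss fewer than \<open>m\<close> vertices of the other side.\<close>
  have large: "r - m \<le> card (nbs T)" if T: "T \<subseteq> ?V" "2 * m \<le> card T" for T
  proof -
    have split: "T = (T \<inter> L) \<union> (T \<inter> R)" using T by blast
    have "card T \<le> card (T \<inter> L) + card (T \<inter> R)" by (subst split) (rule card_Un_le)
    then consider "m \<le> card (T \<inter> L)" | "m \<le> card (T \<inter> R)" using T(2) by linarith
    then obtain Z where Z: "card Z = r" "card (Z - nbs T) < m" "finite Z"
    proof cases
      case 1
      have "card (R - nbs T) \<le> card (R - nbs (T \<inter> L))"
        using fin by (intro card_mono) (auto simp: mem_nbs)
      then show ?thesis using missed[OF _ 1] that[of R] card fin by simp
    next
      case 2
      have "card (L - nbs T) \<le> card (L - nbs (T \<inter> R))"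
        using fin by (intro card_mono) (auto simp: mem_nbs)
      then show ?thesis using missed'[OF _ 2] that[of L] card fin by simp
    qed
    have "card Z - card (nbs T) \<le> card (Z - nbs T)" by (rule diff_card_le_card_Diff[OF fn])
    then show ?thesis using Z by linarith
  qed
  \<comment> \<open>The number \<open>80 * m\<close>, which is also the target size of the growth,
    exceeds the \<open>72 * m + 2\<close> that pays for the dominating set below.\<close>
  define Q where "Q B \<longleftrightarrow> B \<subseteq> ?V \<and> card B \<le> 80 * m \<and> card (nbs B - B) \<le> 3 * card B" for B
  have "Q {}" unfolding Q_def nbs_def by simp
  moreover have "\<forall>B. Q B \<longrightarrow> card B < Suc (80 * m)" unfolding Q_def less_Suc_eq_le by blast
  ultimately have "\<exists>B. Q B \<and> (\<forall>T. Q T \<longrightarrow> card T \<le> card B)" by (rule Lattices_Big.ex_has_greatest_nat)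
  then obtain B where "Q B" and max: "\<And>T. Q T \<Longrightarrow> card T \<le> card B" by blast
  then have B: "B \<subseteq> ?V" "card B \<le> 80 * m" "card (nbs B - B) \<le> 3 * card B" unfolding Q_def by auto
  have fB: "finite B" using B(1) fV finite_subset by blast
  have expand: "3 * card S < card (nbs S - (B \<union> S))"
    if S: "S \<noteq> {}" "S \<subseteq> ?V - B" "card S \<le> 80 * m" for S
  proof (rule ccontr)
    assume "\<not> ?thesis"
    then have le: "card (nbs S - (B \<union> S)) \<le> 3 * card S" by simp
    have fS: "finite S" using S(2) fV finite_subset by blast
    have cu: "card (B \<union> S) = card B + card S" using fB fS S(2) by (intro card_Un_disjoint) auto
    have "nbs (B \<union> S) - (B \<union> S) \<subseteq> (nbs B - B) \<union> (nbs S - (B \<union> S))" by (auto simp: mem_nbs)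
    then have "card (nbs (B \<union> S) - (B \<union> S)) \<le> card ((nbs B - B) \<union> (nbs S - (B \<union> S)))"
      using fn by (intro card_mono) auto
    also have "\<dots> \<le> card (nbs B - B) + card (nbs S - (B \<union> S))" by (rule card_Un_le)
    finally have n: "card (nbs (B \<union> S) - (B \<union> S)) \<le> 3 * card (B \<union> S)" using B(3) le cu by simp
    have pos: "0 < card S" using S(1) fS by (simp add: card_gt_0_iff)
    \<comment> \<open>A badly expanding \<open>S\<close> could be added to \<open>B\<close>. A union
      of size at most \<open>80 * m\<close> contradicts maximality. A larger one has at least
      \<open>r - m\<close> neighbours, but also at most four times its size, hence at most
      \<open>640 * m\<close>, against \<open>700 * m \<le> r\<close>.\<close>
    show False
    proof (cases "card (B \<union> S) \<le> 80 * m")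
      case True
      then have "Q (B \<union> S)" unfolding Q_def using n B(1) S(2) by blast
      then show False using max cu pos by fastforce
    next
      case False
      then have "r - m \<le> card (nbs (B \<union> S))" using B(1) S(2) by (intro large) auto
      moreover have "card (nbs (B \<union> S)) - card (B \<union> S) \<le> card (nbs (B \<union> S) - (B \<union> S))"
        using fB fS by (intro diff_card_le_card_Diff) auto
      ultimately show False using n cu B(2) S(3) m by linarith
    qed
  qed
  have ne: "?V - B \<noteq> {}"
  proof
    assume "?V - B = {}"
    then have "card ?V \<le> card B" using fB by (intro card_mono) auto
    then show False using cV B(2) m by linarith
  qed
  have one: "1 \<le> 80 * m" using m by simp
  obtain S c where S: "core S c" "S \<subseteq> ?V" "3 * c \<le> card S + 1" "80 * m < card S"
  proof (rule grow_core[OF fV _ ne one])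
    show "b \<in> ?V" if "E a b" for a b using that by (rule inV)
    show "3 * card S < card (nbs S - (B \<union> S))" if "S \<noteq> {}" "S \<subseteq> ?V - B" "card S \<le> 80 * m" for S
      using that by (rule expand)
  qed
  have mL: "m \<le> card L" and mR: "m \<le> card R" using m card by auto
  obtain L1 where L1: "L1 \<subseteq> L" "card L1 = m" using mL by (rule obtain_subset_with_card_n)
  obtain R1 where R1: "R1 \<subseteq> R" "card R1 = m" using mR by (rule obtain_subset_with_card_n)
  note 1 = L1 R1
  \<comment> \<open>\<open>L1\<close> and \<open>R1\<close> dominate all but fewer than
    \<open>m\<close> vertices on each side; these exceptions are put into \<open>D\<close>
    themselves.\<close>
  define D where "D = (L1 \<union> R1) \<union> ((R - nbs L1) \<union> (L - nbs R1))"
  have fD: "finite D" unfolding D_def using 1 fin by (auto intro: finite_subset)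
  have "card D \<le> card (L1 \<union> R1) + card ((R - nbs L1) \<union> (L - nbs R1))"
    unfolding D_def by (rule card_Un_le)
  also have "\<dots> \<le> (card L1 + card R1) + (card (R - nbs L1) + card (L - nbs R1))"
    by (intro add_mono card_Un_le)
  also have "\<dots> \<le> 4 * m" using missed[OF 1(1)] missed'[OF 1(3)] 1 by simp
  finally have cD: "card D \<le> 4 * m" .
  let ?U = "{d \<in> D. \<not> insert d (nbs {d}) \<subseteq> S}"
  \<comment> \<open>Multiplied by three and combined with \<open>3 * c \<le> card S + 1\<close> and
    \<open>k \<le> 4 * m\<close>, the claim reduces to \<open>72 * m + 2 < card S\<close>.\<close>
  have "2 * (c + 3 * k) < card S" if "k \<le> card D" for k
  proof -
    have "6 * c + 18 * k < 3 * card S" using that cD S(3,4) m(1) by linarith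
    then show ?thesis by simp
  qed
  moreover have "card ?U \<le> card D" using fD by (intro card_mono) auto
  ultimately have lt: "2 * (c + 3 * card ?U) < card S" .
  have "full ?V (c + 3 * card ?U)"
  proof (rule full_of_dominating_set[OF fV _ con fD _ S(1,2) lt])
    show "b \<in> ?V" if "E a b" for a b using that by (rule inV)
    show "v \<in> D \<or> (\<exists>d\<in>D. E d v)" if "v \<in> ?V" for v
      using that unfolding D_def nbs_def by blast
  qed
  \<comment> \<open>A cost below half of \<open>card S \<le> 2 * r\<close> is below
    \<open>r\<close>.\<close>
  moreover have "c + 3 * k \<le> r" if "2 * (c + 3 * k) < card S" for k
    using that card_mono[OF fV S(2)] cV unfolding add_mult_distrib2 by linarith
  from this[OF lt] have "c + 3 * card ?U \<le> r" .
  ultimately show ?thesis by (rule full_mono)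
qed

end

section \<open>Components of friends-and-strangers graphs\<close>

lemma reachable_invariant:
  assumes "(u, v) \<in> reachable G" "\<And>x y. {x, y} \<in> edges G \<Longrightarrow> f x = f y"
  shows "f u = f v"
proof -
  have "(u, v) \<in> {(x, y). {x, y} \<in> edges G}\<^sup>*" using assms(1) unfolding reachable_def by blast
  then show ?thesis by (induction rule: rtrancl_induct) (use assms(2) in auto)
qed

lemma reachable_edge:
  assumes "(u, v) \<in> reachable G" "{v, w} \<in> edges G" "w \<in> verts G"
  shows "(u, w) \<in> reachable G"
  using assms unfolding reachable_def by (auto intro: rtrancl_into_rtrancl)

lemma verts_FS: "verts (FS X Y) = {\<sigma> \<in> extensional (verts X). bij_betw \<sigma> (verts X) (verts Y)}"
  by (simp add: FS_def Let_def)

lemma FS_edgeE: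
  assumes "{\<sigma>, \<tau>} \<in> edges (FS X Y)"
  obtains a b where "\<sigma> \<in> verts (FS X Y)" "\<tau> \<in> verts (FS X Y)" "{a, b} \<in> edges X" "{\<sigma> a, \<sigma> b} \<in> edges Y"
    "\<tau> a = \<sigma> b" "\<tau> b = \<sigma> a" "\<And>c. c \<in> verts X \<Longrightarrow> c \<noteq> a \<Longrightarrow> c \<noteq> b \<Longrightarrow> \<tau> c = \<sigma> c"
proof -
  from assms obtain \<sigma>' \<tau>' a b where *: "{\<sigma>, \<tau>} = {\<sigma>', \<tau>'}" "\<sigma>' \<in> verts (FS X Y)" "\<tau>' \<in> verts (FS X Y)"
    "{a, b} \<in> edges X" "{\<sigma>' a, \<sigma>' b} \<in> edges Y" "\<sigma>' a = \<tau>' b" "\<sigma>' b = \<tau>' a"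
    "\<forall>c \<in> verts X - {a, b}. \<sigma>' c = \<tau>' c"
    unfolding FS_def Let_def graph.simps mem_Collect_eq by (elim exE conjE) metis
  from *(1) consider "\<sigma> = \<sigma>'" "\<tau> = \<tau>'" | "\<sigma> = \<tau>'" "\<tau> = \<sigma>'" by (metis doubleton_eq_iff)
  then show ?thesis
  proof cases
    case 1
    then show ?thesis using *(2-) by (intro that[of a b]) auto
  next
    case 2
    then show ?thesis using *(2-) by (intro that[of a b]) (auto simp: insert_commute)
  qed
qed

lemma FS_edgeI:
  assumes "\<sigma> \<in> verts (FS X Y)" "\<tau> \<in> verts (FS X Y)" "{a, b} \<in> edges X" "{\<sigma> a, \<sigma> b} \<in> edges Y"
    "\<tau> a = \<sigma> b" "\<tau> b = \<sigma> a" "\<And>c. c \<in> verts X \<Longrightarrow> c \<noteq> a \<Longrightarrow> c \<noteq> b \<Longrightarrow> \<tau> c = \<sigma> c"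
  shows "{\<sigma>, \<tau>} \<in> edges (FS X Y)"
proof -
  have "\<sigma> a = \<tau> b \<and> \<sigma> b = \<tau> a \<and> (\<forall>c \<in> verts X - {a, b}. \<sigma> c = \<tau> c)" using assms(5-7) by auto
  then show ?thesis using assms(1-4) unfolding FS_def Let_def graph.simps mem_Collect_eq by blast
qed

lemma finite_verts_FS:
  assumes "finite (verts X)" "finite (verts Y)"
  shows "finite (verts (FS X Y))"
proof (rule finite_subset)
  show "verts (FS X Y) \<subseteq> (verts X \<rightarrow>\<^sub>E verts Y)"
    unfolding verts_FS by (auto simp: PiE_def bij_betw_def)
  show "finite (verts X \<rightarrow>\<^sub>E verts Y)" using assms by (intro finite_PiE) auto
qed

lemma finite_components_FS:
  assumes "finite (verts X)" "finite (verts Y)"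
  shows "finite (graph_components (FS X Y))"
  unfolding graph_components_def quotient_def using finite_verts_FS[OF assms] by simp

lemma restrict_permutes_FS:
  assumes "\<sigma> permutes verts X" "verts X = verts Y"
  shows "restrict \<sigma> (verts X) \<in> verts (FS X Y)"
  unfolding verts_FS using permutes_imp_bij[OF assms(1)] assms(2) by simp

lemma card_components_isolated:
  assumes "finite (verts X)" "verts X = verts Y" "v \<in> verts X" "\<And>e. e \<in> edges X \<Longrightarrow> v \<notin> e"
  shows "card (verts X) \<le> card (graph_components (FS X Y))"
proof -
  let ?V = "verts X"
  define s where "s q = restrict (transpose v q) ?V" for q
  define f where "f q = reachable (FS X Y) `` {s q}" for q
  have s: "s q \<in> verts (FS X Y)" if "q \<in> ?V" for q
    unfolding s_def using assms(2) permutes_swap_id[OF assms(3) that] by (intro restrict_permutes_FS)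
  have "inj_on f ?V"
  proof (rule inj_onI)
    fix q q' assume q: "q \<in> ?V" "q' \<in> ?V" "f q = f q'"
    then have "(s q, s q') \<in> reachable (FS X Y)"
      unfolding f_def by (intro eq_equiv_class[OF _ equiv_reachable s])
    then have "s q v = s q' v"
    proof (rule reachable_invariant)
      fix \<sigma> \<tau> assume "{\<sigma>, \<tau>} \<in> edges (FS X Y)"
      then show "\<sigma> v = \<tau> v" by (rule FS_edgeE) (use assms(3,4) in fastforce)
    qed
    then show "q = q'" using assms(3) unfolding s_def by simp
  qed
  moreover have "f ` ?V \<subseteq> graph_components (FS X Y)"
    unfolding f_def graph_components_def quotient_def using s by blast
  moreover have "finite (graph_components (FS X Y))"
    using assms finite_components_FS[of X Y] by simp
  ultimately show ?thesis using card_inj_on_le by blast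
qed

section \<open>Parity, and exactly two components\<close>

lemma verts_complete_bipartite: "verts (complete_bipartite r r) = {..<r} <+> {..<r}"
  by (simp add: complete_bipartite_def)

lemma edge_complete_bipartite_iff:
  "{a, b} \<in> edges (complete_bipartite r r) \<longleftrightarrow>
     a \<in> {..<r} <+> {..<r} \<and> b \<in> {..<r} <+> {..<r} \<and> isl a \<noteq> isl b"
  by (cases a; cases b) (auto simp: complete_bipartite_def doubleton_eq_iff)

text \<open>The sign needs a permutation of the whole type, whereas vertices of \<open>FS\<close>
  are \<open>undefined\<close> outside the vertex set; hence the extension by the identity. A move
  flips both sides of the equivalence, so its truth value is invariant.\<close>

definition parity :: "nat \<Rightarrow> (nat + nat \<Rightarrow> nat + nat) \<Rightarrow> bool" where
  "parity r \<sigma> \<longleftrightarrow>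
     (evenperm (\<lambda>v. if v \<in> {..<r} <+> {..<r} then \<sigma> v else v) \<longleftrightarrow> even (card {i. i < r \<and> isl (\<sigma> (Inl i))}))"

lemma permutes_extend:
  assumes "bij_betw \<sigma> V V"
  shows "(\<lambda>v. if v \<in> V then \<sigma> v else v) permutes V"
proof (rule bij_imp_permutes)
  show "bij_betw (\<lambda>v. if v \<in> V then \<sigma> v else v) V V"
    using assms by (subst bij_betw_cong[of _ _ \<sigma>]) auto
qed simp

lemma parity_FS_edge:
  assumes X: "X \<in> edge_subgraphs (complete_bipartite r r)"
    and "{\<sigma>, \<tau>} \<in> edges (FS X (complete_bipartite r r))"
  shows "parity r \<sigma> = parity r \<tau>"
proof -
  let ?V = "{..<r} <+> {..<r}"
  have VX: "verts X = ?V" using X unfolding edge_subgraphs_def by (simp add: verts_complete_bipartite)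
  obtain a b where \<sigma>: "bij_betw \<sigma> ?V ?V" "bij_betw \<tau> ?V ?V" and e: "{a, b} \<in> edges X" "{\<sigma> a, \<sigma> b} \<in> edges (complete_bipartite r r)"
    and sw: "\<tau> a = \<sigma> b" "\<tau> b = \<sigma> a" "\<And>c. c \<in> ?V \<Longrightarrow> c \<noteq> a \<Longrightarrow> c \<noteq> b \<Longrightarrow> \<tau> c = \<sigma> c"
    by (rule FS_edgeE[OF assms(2)]) (auto simp: verts_FS VX verts_complete_bipartite)
  have "{a, b} \<in> edges (complete_bipartite r r)" using e(1) X unfolding edge_subgraphs_def by blast
  then have ab: "a \<in> ?V" "b \<in> ?V" "isl a \<noteq> isl b" unfolding edge_complete_bipartite_iff by auto
  have c: "isl (\<sigma> a) \<noteq> isl (\<sigma> b)" using e(2) unfolding edge_complete_bipartite_iff by auto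
  let ?ext = "\<lambda>\<sigma> v. if v \<in> ?V then \<sigma> v else v"
  have "?ext \<tau> v = (?ext \<sigma> \<circ> transpose a b) v" for v
  proof -
    consider "v = a" | "v = b" | "v \<noteq> a" "v \<noteq> b" by blast
    then show ?thesis
    proof cases
      case 3
      then show ?thesis using sw(3)[of v] by (simp add: transpose_apply_other)
    qed (use ab(1,2) sw(1,2) in simp_all)
  qed
  then have "?ext \<tau> = ?ext \<sigma> \<circ> transpose a b" by (rule ext)
  moreover have "permutation (?ext \<sigma>)"
    by (rule permutation_permutes[THEN iffD2]) (intro exI[of _ ?V] conjI permutes_extend[OF \<sigma>(1)], simp)
  ultimately have 1: "evenperm (?ext \<tau>) \<longleftrightarrow> \<not> evenperm (?ext \<sigma>)"
    using ab(3) by (auto simp: evenperm_comp permutation_swap_id evenperm_swap)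
  \<comment> \<open>Exactly one end of the edge is on the left. Only the occupant of that place
    \<open>k\<close> matters to the count, and it is replaced by somebody of the other side.\<close>
  have 2: "even (card {i. i < r \<and> isl (\<tau> (Inl i))}) \<longleftrightarrow> odd (card {i. i < r \<and> isl (\<sigma> (Inl i))})"
    if "Inl k = a \<and> Inr l = b \<or> Inl k = b \<and> Inr l = a" for k l
  proof -
    have k: "k < r" using that ab(1,2) by auto
    have eq: "\<tau> (Inl i) = \<sigma> (Inl i)" if "i < r" "i \<noteq> k" for i
      using that \<open>Inl k = a \<and> Inr l = b \<or> Inl k = b \<and> Inr l = a\<close> by (intro sw(3)) auto
    have kk: "isl (\<tau> (Inl k)) \<noteq> isl (\<sigma> (Inl k))" using that c sw(1,2) by auto
    let ?S = "\<lambda>\<sigma>. {i. i < r \<and> i \<noteq> k \<and> isl (\<sigma> (Inl i))}"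
    have S: "{i. i < r \<and> isl (\<sigma> (Inl i))} = (if isl (\<sigma> (Inl k)) then insert k (?S \<sigma>) else ?S \<sigma>)" for \<sigma> :: "nat + nat \<Rightarrow> nat + nat"
      using k by auto
    have "?S \<tau> = ?S \<sigma>" using eq by auto
    then show ?thesis using kk by (subst (1 2) S) auto
  qed
  from ab(3) obtain k l where "Inl k = a \<and> Inr l = b \<or> Inl k = b \<and> Inr l = a"
    by (cases a; cases b) auto
  from 2[OF this] show ?thesis using 1 unfolding parity_def by blast
qed

text \<open>Fullness is applied from the fixed start \<open>id\<close>, where each colour occurs
  \<open>r\<close> times. Its two outcomes make \<open>id\<close> and one transposition of two left
  people representatives of all components.\<close>

lemma card_components_eq_2:
  assumes X: "X \<in> edge_subgraphs (complete_bipartite r r)" and r: "2 \<le> r"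
    and full: "token_swapping.full (\<lambda>a b. {a, b} \<in> edges X) (isl :: nat + nat \<Rightarrow> bool) (verts X) r"
  shows "card (graph_components (FS X (complete_bipartite r r))) = 2"
proof -
  let ?Y = "complete_bipartite r r"
  let ?V = "{..<r} <+> {..<r}"
  let ?E = "\<lambda>a b. {a, b} \<in> edges X"
  have VX: "verts X = ?V" using X unfolding edge_subgraphs_def by (simp add: verts_complete_bipartite)
  have EX: "edges X \<subseteq> edges ?Y" using X unfolding edge_subgraphs_def by blast
  interpret token_swapping ?E "isl :: nat + nat \<Rightarrow> bool"
  proof
    show "?E b a" if "?E a b" for a b using that by (simp add: insert_commute)
    show "\<not> ?E a a" for a using EX edge_complete_bipartite_iff[of a a r] by blast
  qed
  let ?F = "FS X ?Y"
  have vF: "restrict \<sigma> ?V \<in> verts ?F" if "\<sigma> permutes ?V" for \<sigma>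
    using restrict_permutes_FS[of \<sigma> X ?Y] that by (simp add: VX verts_complete_bipartite)
  \<comment> \<open>Moves take place among bijections of the whole type; restricting permutations of
    \<open>?V\<close> turns them into edges of \<open>FS\<close>.\<close>
  have reachF: "\<tau> permutes ?V \<and> (restrict \<sigma> ?V, restrict \<tau> ?V) \<in> reachable ?F"
    if "reach ?V \<sigma> \<tau>" "\<sigma> permutes ?V" for \<sigma> \<tau>
    using that(1)
  proof (induction rule: rtranclp_induct)
    case base
    have "(restrict \<sigma> ?V, restrict \<sigma> ?V) \<in> reachable ?F"
      using vF[OF that(2)] by (simp add: reachable_def)
    then show ?case using that(2) by blast
  next
    case (step \<tau> \<upsilon>)
    obtain a b where ab: "a \<in> ?V" "b \<in> ?V" "?E a b" "isl (\<tau> a) \<noteq> isl (\<tau> b)" "\<upsilon> = \<tau> \<circ> transpose a b"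
      using step.hyps(2) unfolding step_def by blast
    have t: "\<tau> permutes ?V" and rt: "(restrict \<sigma> ?V, restrict \<tau> ?V) \<in> reachable ?F" using step.IH by blast+
    have u: "\<upsilon> permutes ?V"
      unfolding ab(5) by (rule permutes_compose[OF permutes_swap_id[OF ab(1,2)] t])
    have tV: "\<tau> a \<in> ?V" "\<tau> b \<in> ?V" using permutes_in_image[OF t] ab(1,2) by blast+
    have "{restrict \<tau> ?V, restrict \<upsilon> ?V} \<in> edges ?F"
    proof (rule FS_edgeI[OF vF[OF t] vF[OF u] ab(3)])
      show "{restrict \<tau> ?V a, restrict \<tau> ?V b} \<in> edges ?Y"
        unfolding edge_complete_bipartite_iff using tV ab by simp
    qed (use ab VX in auto)
    then show ?case using reachable_edge[OF rt _ vF[OF u]] u by blast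
  qed
  let ?x = "Inl 0 :: nat + nat" and ?y = "Inl 1 :: nat + nat"
  have xy: "?x \<in> ?V" "?y \<in> ?V" using r by auto
  have id: "id permutes ?V" by (rule permutes_id)
  have tr: "transpose ?x ?y permutes ?V" by (rule permutes_swap_id[OF xy])
  have cnt: "r \<le> cnt ?V id k" for k
  proof (cases k)
    case True
    have "{s \<in> ?V. isl (id s) = k} = Inl ` {..<r}" using True by auto
    then show ?thesis unfolding cnt_def by (simp add: card_image)
  next
    case False
    have "{s \<in> ?V. isl (id s) = k} = Inr ` {..<r}" using False by auto
    then show ?thesis unfolding cnt_def by (simp add: card_image)
  qed
  let ?c = "\<lambda>\<sigma>. reachable ?F `` {restrict \<sigma> ?V}"
  have "graph_components ?F \<subseteq> {?c id, ?c (transpose ?x ?y)}"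
  proof
    fix C assume "C \<in> graph_components ?F"
    then obtain \<sigma> where \<sigma>: "\<sigma> \<in> verts ?F" "C = reachable ?F `` {\<sigma>}"
      unfolding graph_components_def by (rule quotientE)
    have bs: "bij_betw \<sigma> ?V ?V" "\<sigma> \<in> extensional ?V"
      using \<sigma>(1) unfolding verts_FS VX verts_complete_bipartite by auto
    define \<tau> where "\<tau> = (\<lambda>v. if v \<in> ?V then \<sigma> v else v)"
    have \<tau>: "\<tau> permutes ?V" unfolding \<tau>_def by (rule permutes_extend[OF bs(1)])
    have res: "restrict \<tau> ?V = \<sigma>" using bs(2) unfolding \<tau>_def by (auto simp: extensional_def)
    have "reach ?V id \<tau> \<or> reach ?V id (transpose ?x ?y \<circ> \<tau>)"
      by (rule fullD[OF full[unfolded VX] _ permutes_bij[OF \<tau>] _ cnt]) (use xy in \<open>auto simp: \<tau>_def\<close>)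
    \<comment> \<open>Relabelling shifts the transposition from the target to the start, where it no
      longer depends on \<open>\<tau>\<close>.\<close>
    then have "reach ?V id \<tau> \<or> reach ?V (transpose ?x ?y) \<tau>"
    proof
      assume "reach ?V id (transpose ?x ?y \<circ> \<tau>)"
      from reach_transpose_relabel[OF this, of ?x ?y]
      have "reach ?V (transpose ?x ?y) (transpose ?x ?y \<circ> (transpose ?x ?y \<circ> \<tau>))" by simp
      then show ?thesis by (simp add: comp_assoc[symmetric])
    qed blast
    then have "(restrict id ?V, \<sigma>) \<in> reachable ?F \<or> (restrict (transpose ?x ?y) ?V, \<sigma>) \<in> reachable ?F"
      using reachF[OF _ id, of \<tau>] reachF[OF _ tr, of \<tau>] res by metis
    then show "C \<in> {?c id, ?c (transpose ?x ?y)}"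
      unfolding \<sigma>(2) using equiv_class_eq[OF equiv_reachable[of ?F]] by blast
  qed
  moreover have "{?c id, ?c (transpose ?x ?y)} \<subseteq> graph_components ?F"
    unfolding graph_components_def quotient_def using vF[OF id] vF[OF tr] by blast
  \<comment> \<open>All \<open>r\<close> left people stand on the left in both arrangements, but the
    signs differ.\<close>
  moreover have "?c id \<noteq> ?c (transpose ?x ?y)"
  proof
    assume "?c id = ?c (transpose ?x ?y)"
    then have "(restrict id ?V, restrict (transpose ?x ?y) ?V) \<in> reachable ?F"
      by (rule eq_equiv_class[OF _ equiv_reachable vF[OF tr]])
    then have "parity r (restrict id ?V) = parity r (restrict (transpose ?x ?y) ?V)"
      by (rule reachable_invariant) (rule parity_FS_edge[OF X])
    moreover have "(\<lambda>v. if v \<in> ?V then restrict id ?V v else v) = id" by auto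
    moreover have "(\<lambda>v. if v \<in> ?V then restrict (transpose ?x ?y) ?V v else v) = transpose ?x ?y"
      using xy by (auto simp: fun_eq_iff Transposition.transpose_def)
    moreover have "{i. i < r \<and> isl (restrict id ?V (Inl i))} = {..<r}" by auto
    moreover have "{i. i < r \<and> isl (restrict (transpose ?x ?y) ?V (Inl i))} = {..<r}"
      by (auto simp: Transposition.transpose_def)
    ultimately show False unfolding parity_def by (simp add: evenperm_swap evenperm_id)
  qed
  ultimately have "graph_components ?F = {?c id, ?c (transpose ?x ?y)}" by blast
  then show ?thesis using \<open>?c id \<noteq> ?c (transpose ?x ?y)\<close> by simp
qed

section \<open>Random subgraphs\<close>

lemma prob_avoid:
  assumes "finite (edges G)" "F \<subseteq> edges G" "0 \<le> p" "p \<le> 1"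
  shows "measure_pmf.prob (random_edge_subgraph G p) {X. edges X \<inter> F = {}} = (1 - p) ^ card F"
proof -
  let ?B = "\<lambda>e. if e \<in> F then {False} else UNIV"
  have "measure_pmf.prob (random_edge_subgraph G p) {X. edges X \<inter> F = {}} =
      measure_pmf.prob (Pi_pmf (edges G) False (\<lambda>_. bernoulli_pmf p)) (Pi (edges G) ?B)"
    unfolding random_edge_subgraph_def measure_map_pmf
    by (rule arg_cong[where f = "measure _"]) (use assms(2) in \<open>auto simp: Pi_def\<close>)
  also have "\<dots> = (\<Prod>e\<in>edges G. measure_pmf.prob (bernoulli_pmf p) (?B e))"
    by (rule measure_Pi_pmf_Pi[OF assms(1)])
  also have "\<dots> = (\<Prod>e\<in>edges G. if e \<in> F then 1 - p else 1)"
    using assms(3,4) by (intro prod.cong) (auto simp: measure_pmf_single)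
  also have "\<dots> = (\<Prod>e\<in>edges G \<inter> F. 1 - p)"
    using assms(1) by (simp only: prod.inter_restrict)
  also have "edges G \<inter> F = F" using assms(2) by blast
  finally show ?thesis by simp
qed

text \<open>Independence of disjoint edge sets, by induction: the event of hitting
  \<open>F j\<close> is the difference of the event without this demand and the one in which
  \<open>F j\<close> is avoided. The additional avoided set \<open>A\<close> gives both the same
  shape.\<close>

lemma prob_hit_all:
  assumes "finite (edges G)" "0 \<le> p" "p \<le> 1" "finite I"
    and "\<And>i. i \<in> I \<Longrightarrow> F i \<subseteq> edges G" "disjoint_family_on F I"
    and "A \<subseteq> edges G" "\<And>i. i \<in> I \<Longrightarrow> A \<inter> F i = {}"
  shows "measure_pmf.prob (random_edge_subgraph G p) {X. (\<forall>i\<in>I. edges X \<inter> F i \<noteq> {}) \<and> edges X \<inter> A = {}} =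
    (\<Prod>i\<in>I. 1 - (1 - p) ^ card (F i)) * (1 - p) ^ card A"
  using assms(4-)
proof (induction I arbitrary: A)
  case empty
  then show ?case using prob_avoid[OF assms(1) _ assms(2,3)] by simp
next
  case (insert j I)
  let ?P = "measure_pmf.prob (random_edge_subgraph G p)"
  let ?H = "\<lambda>A. {X. (\<forall>i\<in>I. edges X \<inter> F i \<noteq> {}) \<and> edges X \<inter> A = {}}"
  let ?c = "\<Prod>i\<in>I. 1 - (1 - p) ^ card (F i)"
  have dis: "disjoint_family_on F I"
    by (rule disjoint_family_on_mono[OF _ insert.prems(2)]) blast
  have j: "F j \<inter> F i = {}" if "i \<in> I" for i
    by (rule disjoint_family_onD[OF insert.prems(2)]) (use insert.hyps(2) that in auto)
  have 2: "?P (?H (A \<union> F j)) = ?c * (1 - p) ^ card (A \<union> F j)"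
  proof (rule insert.IH[OF _ dis])
    show "A \<union> F j \<subseteq> edges G" using insert.prems(1,3) by simp
    show "(A \<union> F j) \<inter> F i = {}" if "i \<in> I" for i
      using insert.prems(4)[of i] that j[OF that] by (simp add: Int_Un_distrib2)
  qed (simp add: insert.prems)
  have 1: "?P (?H A) = ?c * (1 - p) ^ card A"
    by (rule insert.IH[OF _ dis]) (simp_all add: insert.prems)
  have fin: "finite A" "finite (F j)"
    using insert.prems(1,3) assms(1) finite_subset by blast+
  then have card: "card (A \<union> F j) = card A + card (F j)"
    using insert.prems(4) by (intro card_Un_disjoint) auto
  have "{X. (\<forall>i\<in>insert j I. edges X \<inter> F i \<noteq> {}) \<and> edges X \<inter> A = {}} = ?H A - ?H (A \<union> F j)"
    by blast
  then have "?P {X. (\<forall>i\<in>insert j I. edges X \<inter> F i \<noteq> {}) \<and> edges X \<inter> A = {}} = ?P (?H A - ?H (A \<union> F j))"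
    by (rule arg_cong)
  also have "\<dots> = ?P (?H A) - ?P (?H (A \<union> F j))"
    by (rule measure_pmf.finite_measure_Diff) auto
  also have "\<dots> = ?c * (1 - p) ^ card A - ?c * (1 - p) ^ (card A + card (F j))"
    unfolding 1 2 card ..
  also have "\<dots> = (\<Prod>i\<in>insert j I. 1 - (1 - p) ^ card (F i)) * (1 - p) ^ card A"
    using insert.hyps by (simp add: algebra_simps power_add)
  finally show ?case .
qed

lemma prob_some_avoided_le:
  assumes "finite (edges G)" "0 \<le> p" "p \<le> 1" "finite I" "\<And>i. i \<in> I \<Longrightarrow> F i \<subseteq> edges G"
  shows "measure_pmf.prob (random_edge_subgraph G p) {X. \<exists>i\<in>I. edges X \<inter> F i = {}} \<le>
    (\<Sum>i\<in>I. (1 - p) ^ card (F i))"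
proof -
  have eq: "{X. \<exists>i\<in>I. edges X \<inter> F i = {}} = (\<Union>i\<in>I. {X. edges X \<inter> F i = {}})" by blast
  have "measure_pmf.prob (random_edge_subgraph G p) {X. \<exists>i\<in>I. edges X \<inter> F i = {}} \<le>
      (\<Sum>i\<in>I. measure_pmf.prob (random_edge_subgraph G p) {X. edges X \<inter> F i = {}})"
    unfolding eq by (rule measure_pmf.finite_measure_subadditive_finite[OF assms(4)]) simp
  also have "\<dots> = (\<Sum>i\<in>I. (1 - p) ^ card (F i))"
    using assms by (intro sum.cong refl prob_avoid) auto
  finally show ?thesis .
qed

section \<open>Stars, cuts and holes in the random subgraph\<close>

definition bip_edge :: "nat \<times> nat \<Rightarrow> (nat + nat) set" where
  "bip_edge = (\<lambda>(i, j). {Inl i, Inr j})"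

lemma inj_bip_edge: "inj bip_edge"
  by (auto simp: bip_edge_def inj_def doubleton_eq_iff)

lemma edges_complete_bipartite: "edges (complete_bipartite r r) = bip_edge ` ({..<r} \<times> {..<r})"
  unfolding complete_bipartite_def bip_edge_def by auto

lemma finite_edges_complete_bipartite: "finite (edges (complete_bipartite r r))"
  unfolding edges_complete_bipartite by simp

lemma card_bip_edge: "card (bip_edge ` P) = card P"
  by (rule card_image) (rule inj_on_subset[OF inj_bip_edge], simp)

lemma one_minus_power_le_exp: "0 \<le> p \<Longrightarrow> p \<le> 1 \<Longrightarrow> (1 - p) ^ n \<le> exp (- p * real n)"
  for p :: real
proof -
  assume p: "0 \<le> p" "p \<le> 1"
  have "(1 - p) ^ n \<le> exp (- p) ^ n" using p exp_ge_add_one_self[of "- p"] by (intro power_mono) auto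
  also have "\<dots> = exp (- p * real n)" by (simp add: exp_of_nat_mult[symmetric] mult.commute)
  finally show ?thesis .
qed

text \<open>A single term of the exponential series; it serves in place of Stirling's
  formula.\<close>

lemma power_div_fact_le_exp: "real k ^ k / fact k \<le> exp (real k)"
proof -
  have "(\<Sum>n\<in>{k}. real k ^ n /\<^sub>R fact n) \<le> (\<Sum>n. real k ^ n /\<^sub>R fact n)"
    by (rule sum_le_suminf[OF summable_exp_generic]) auto
  then show ?thesis by (simp add: exp_def divide_inverse mult.commute)
qed

definition cut_pairs :: "nat \<Rightarrow> (nat + nat) set \<Rightarrow> (nat \<times> nat) set" where
  "cut_pairs r A = {(i, j). i < r \<and> j < r \<and> (Inl i \<in> A) \<noteq> (Inr j \<in> A)}"

text \<open>With \<open>s\<close> and \<open>t\<close> vertices of \<open>A\<close> on the two sides, the cut has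
  \<open>s (r - t) + (r - s) t = r (s + t) - 2 s t\<close> edges, and \<open>4 s t \<le> (s + t)\<^sup>2\<close>.\<close>
lemma card_cut_pairs_ge:
  assumes "A \<subseteq> {..<r} <+> {..<r}"
  shows "real r * card A - (real (card A))\<^sup>2 / 2 \<le> card (cut_pairs r A)"
proof -
  define S where "S = {i. i < r \<and> Inl i \<in> A}"
  define T where "T = {j. j < r \<and> Inr j \<in> A}"
  have fin: "finite S" "finite T" and sub: "S \<subseteq> {..<r}" "T \<subseteq> {..<r}" unfolding S_def T_def by auto
  have "A = Inl ` S \<union> Inr ` T" using assms unfolding S_def T_def by auto
  moreover have "card (Inl ` S \<union> Inr ` T) = card (Inl ` S :: (nat + nat) set) + card (Inr ` T :: (nat + nat) set)"
    using fin by (intro card_Un_disjoint) auto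
  ultimately have cA: "card A = card S + card T" by (simp add: card_image)
  have "cut_pairs r A = S \<times> ({..<r} - T) \<union> ({..<r} - S) \<times> T" unfolding cut_pairs_def S_def T_def by auto
  moreover have "card (S \<times> ({..<r} - T) \<union> ({..<r} - S) \<times> T) =
      card (S \<times> ({..<r} - T)) + card (({..<r} - S) \<times> T)"
    using fin by (intro card_Un_disjoint) auto
  ultimately have "card (cut_pairs r A) = card S * (r - card T) + (r - card S) * card T"
    using fin sub by (simp add: card_cartesian_product card_Diff_subset)
  moreover have "card S \<le> r" "card T \<le> r" using sub card_mono[of "{..<r}"] by fastforce+
  ultimately have "real (card (cut_pairs r A)) = real (card S) * (real r - card T) + (real r - card S) * card T"
    by (simp add: of_nat_diff)
  moreover have "0 \<le> (real (card S) - real (card T))\<^sup>2" by simp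
  ultimately show ?thesis unfolding cA by (simp add: field_simps power2_eq_square)
qed

lemma prob_ge_one_minus:
  assumes "\<And>x. x \<in> set_pmf M \<Longrightarrow> x \<notin> B \<Longrightarrow> x \<in> A"
  shows "1 - measure_pmf.prob M B \<le> measure_pmf.prob M A"
proof -
  have "1 - measure_pmf.prob M B = measure_pmf.prob M (- B)"
    using measure_pmf.prob_compl[of B M] by (simp add: Compl_eq_Diff_UNIV)
  also have "\<dots> = measure_pmf.prob M (- B \<inter> set_pmf M)" by (rule measure_Int_set_pmf[symmetric])
  also have "\<dots> \<le> measure_pmf.prob M A"
    by (rule measure_pmf.finite_measure_mono) (use assms in auto)
  finally show ?thesis .
qed

lemma edge_subgraph_edgeE:
  assumes "X \<in> edge_subgraphs (complete_bipartite r r)" "e \<in> edges X"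
  obtains i j where "i < r" "j < r" "e = bip_edge (i, j)"
  using assms unfolding edge_subgraphs_def edges_complete_bipartite by blast

text \<open>The stars of the left vertices are disjoint, so the probability that none of these
  vertices is isolated is an exact power and no second moment enters.\<close>

lemma prob_many_components_ge:
  assumes p: "0 \<le> p" "p \<le> 1" and r: "2 \<le> r"
  shows "1 - (1 - (1 - p) ^ r) ^ r \<le>
    measure_pmf.prob (random_edge_subgraph (complete_bipartite r r) p)
      {X. card (graph_components (FS X (complete_bipartite r r))) > 2}"
proof -
  let ?K = "complete_bipartite r r"
  let ?F = "\<lambda>i. bip_edge ` ({i} \<times> {..<r})"
  let ?B = "{X. (\<forall>i\<in>{..<r}. edges X \<inter> ?F i \<noteq> {}) \<and> edges X \<inter> {} = {}}"
  have "measure_pmf.prob (random_edge_subgraph ?K p) ?B = (\<Prod>i\<in>{..<r}. 1 - (1 - p) ^ card (?F i)) * (1 - p) ^ card ({} :: (nat + nat) set set)"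
  proof (rule prob_hit_all[OF finite_edges_complete_bipartite p])
    show "disjoint_family_on ?F {..<r}"
      unfolding disjoint_family_on_def by (auto dest!: injD[OF inj_bip_edge])
  qed (auto simp: edges_complete_bipartite)
  also have "\<dots> = (1 - (1 - p) ^ r) ^ r" by (simp only: card_bip_edge) simp
  finally have B: "measure_pmf.prob (random_edge_subgraph ?K p) ?B = (1 - (1 - p) ^ r) ^ r" .
  show ?thesis
    unfolding B[symmetric]
  proof (rule prob_ge_one_minus)
    fix X assume "X \<in> set_pmf (random_edge_subgraph ?K p)" "X \<notin> ?B"
    then have X: "X \<in> edge_subgraphs ?K" and "\<exists>i<r. edges X \<inter> ?F i = {}"
      using set_random_edge_subgraph by auto
    then obtain i where i: "i < r" "edges X \<inter> ?F i = {}" by blast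
    have VX: "verts X = {..<r} <+> {..<r}" using X by (simp add: edge_subgraphs_def verts_complete_bipartite)
    have "card (verts X) \<le> card (graph_components (FS X ?K))"
    proof (rule card_components_isolated)
      show "Inl i \<notin> e" if eX: "e \<in> edges X" for e
      proof
        assume "Inl i \<in> e"
        moreover obtain i' j where e: "i' < r" "j < r" "e = bip_edge (i', j)"
          by (rule edge_subgraph_edgeE[OF X eX])
        ultimately have "e = bip_edge (i, j)" by (auto simp: bip_edge_def)
        then have "e \<in> ?F i" using e(2) by blast
        then show False using eX i(2) by blast
      qed
    qed (use i in \<open>auto simp: VX verts_complete_bipartite\<close>)
    moreover have "card (verts X) = r + r" unfolding VX by (simp add: card_Plus)
    ultimately show "X \<in> {X. card (graph_components (FS X ?K)) > 2}" using r by simp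
  qed
qed

lemma full_of_no_empty_cut_no_hole:
  assumes X: "X \<in> edge_subgraphs (complete_bipartite r r)"
    and m: "1 \<le> m" "700 * m \<le> r"
    and cuts: "\<And>A. A \<subseteq> {..<r} <+> {..<r} \<Longrightarrow> A \<noteq> {} \<Longrightarrow> card A \<le> r \<Longrightarrow> edges X \<inter> bip_edge ` cut_pairs r A \<noteq> {}"
    and holes: "\<And>A B. A \<subseteq> {..<r} \<Longrightarrow> B \<subseteq> {..<r} \<Longrightarrow> card A = m \<Longrightarrow> card B = m \<Longrightarrow>
      edges X \<inter> bip_edge ` (A \<times> B) \<noteq> {}"
  shows "token_swapping.full (\<lambda>a b. {a, b} \<in> edges X) (isl :: nat + nat \<Rightarrow> bool) (verts X) r"
proof -
  let ?V = "{..<r} <+> {..<r} :: (nat + nat) set"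
  let ?L = "Inl ` {..<r} :: (nat + nat) set"
  let ?R = "Inr ` {..<r} :: (nat + nat) set"
  let ?E = "\<lambda>a b. {a, b} \<in> edges X"
  have VX: "verts X = ?V" using X unfolding edge_subgraphs_def by (simp add: verts_complete_bipartite)
  have EX: "edges X \<subseteq> edges (complete_bipartite r r)" using X unfolding edge_subgraphs_def by blast
  interpret token_swapping ?E "isl :: nat + nat \<Rightarrow> bool"
  proof
    show "?E b a" if "?E a b" for a b using that by (simp add: insert_commute)
    show "\<not> ?E a a" for a using EX edge_complete_bipartite_iff[of a a r] by blast
  qed
  have V: "?V = ?L \<union> ?R" by (rule Plus_def)
  have "full (?L \<union> ?R) r"
  proof (rule full_of_connected_no_holes[OF _ _ _ _ _ _ _ _ m])
    show "a \<in> ?L \<and> b \<in> ?R \<or> a \<in> ?R \<and> b \<in> ?L" if "?E a b" for a b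
    proof -
      have "{a, b} \<in> edges (complete_bipartite r r)" using that EX by blast
      then show ?thesis unfolding edge_complete_bipartite_iff by (cases a; cases b) auto
    qed
    show "conn (?L \<union> ?R)"
      unfolding conn_def V[symmetric]
    proof (intro allI impI)
      fix A assume A: "A \<subseteq> ?V" "A \<noteq> {}" "A \<noteq> ?V"
      have cV: "card ?V = r + r" by (simp add: card_Plus)
      have fA: "finite A" by (rule finite_subset[OF A(1)]) simp
      have "edges X \<inter> bip_edge ` cut_pairs r A \<noteq> {}"
      proof (cases "card A \<le> r")
        case True
        then show ?thesis using cuts A by blast
      next
        case False
        \<comment> \<open>A large set is replaced by its complement, which has the same cut.\<close>
        then have "card (?V - A) \<le> r" using card_Diff_subset[OF fA A(1)] cV by simp
        moreover have "?V - A \<noteq> {}" using A by blast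
        ultimately have "edges X \<inter> bip_edge ` cut_pairs r (?V - A) \<noteq> {}" by (intro cuts) auto
        moreover have "cut_pairs r (?V - A) = cut_pairs r A" unfolding cut_pairs_def by auto
        ultimately show ?thesis by simp
      qed
      then obtain q where "q \<in> cut_pairs r A" "bip_edge q \<in> edges X" by blast
      then obtain i j where ij: "(i, j) \<in> cut_pairs r A" "bip_edge (i, j) \<in> edges X" by (cases q) blast
      then have e: "?E (Inl i) (Inr j)" "?E (Inr j) (Inl i)" by (simp_all add: bip_edge_def insert_commute)
      have lt: "Inl i \<in> ?V" "Inr j \<in> ?V" "(Inl i \<in> A) \<noteq> (Inr j \<in> A)" using ij(1) unfolding cut_pairs_def by auto
      show "\<exists>a\<in>A. \<exists>b\<in>?V - A. ?E a b"
      proof (cases "Inl i \<in> A")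
        case True
        then show ?thesis using lt e(1) by (intro bexI[of _ "Inl i"] bexI[of _ "Inr j"]) auto
      next
        case False
        then show ?thesis using lt e(2) by (intro bexI[of _ "Inr j"] bexI[of _ "Inl i"]) auto
      qed
    qed
    show "\<exists>a\<in>A. \<exists>b\<in>B. ?E a b" if AB: "A \<subseteq> ?L" "B \<subseteq> ?R" "card A = m" "card B = m" for A B
    proof -
      define A0 where "A0 = Inl -` A"
      define B0 where "B0 = Inr -` B"
      have A: "A = Inl ` A0" and B: "B = Inr ` B0" unfolding A0_def B0_def using AB(1,2) by auto
      have "edges X \<inter> bip_edge ` (A0 \<times> B0) \<noteq> {}"
        by (rule holes) (use AB in \<open>auto simp: A B card_image\<close>)
      then obtain i j where "i \<in> A0" "j \<in> B0" "bip_edge (i, j) \<in> edges X" by blast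
      then show ?thesis unfolding A B bip_edge_def by auto
    qed
  qed (auto simp: card_image)
  then show ?thesis by (simp only: VX V)
qed

section \<open>Estimates for empty cuts and holes\<close>

text \<open>The binomial is at most \<open>2 ^ k * (r / k) ^ k * exp k\<close>. The term
  \<open>k * k / 2\<close> missing from the cut size seems dangerous for \<open>k\<close> near
  \<open>r\<close>, but \<open>k / r * ln (r / k) \<le> 1\<close> shows that it costs at most
  \<open>k / 2 * (1 + ln k + w)\<close>. The \<open>ln k\<close> part is paid for by
  \<open>k ^ k\<close> in the denominator, half of \<open>w\<close> survives, and
  \<open>3 / 2\<close> collects \<open>1\<close> from the binomial and \<open>1 / 2\<close> from
  this loss.\<close>

lemma cut_term_bound:
  assumes k: "1 \<le> k" "k \<le> r" and w: "0 \<le> w" and p: "p = (ln (real r) + w) / real r"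
  shows "real (2 * r choose k) * exp (- p * (real r * real k - (real k)\<^sup>2 / 2)) \<le> (2 * exp (3 / 2 - w / 2)) ^ k"
proof -
  have pos: "0 < real k" "0 < real r" "real k \<le> real r" using k by auto
  have "real (2 * r choose k) * fact k \<le> real ((2 * r) ^ k)"
    using binomial_fact_pow[of "2 * r" k] by (metis of_nat_fact of_nat_le_iff of_nat_mult)
  then have "real (2 * r choose k) \<le> (2 * real r) ^ k / fact k"
    by (simp add: pos_le_divide_eq)
  also have "\<dots> = 2 ^ k * (real r ^ k / real k ^ k) * (real k ^ k / fact k)"
    using pos by (simp add: power_mult_distrib)
  also have "\<dots> \<le> 2 ^ k * (real r ^ k / real k ^ k) * exp (real k)"
    by (intro mult_left_mono power_div_fact_le_exp) auto
  also have "real r ^ k / real k ^ k = exp (real k * (ln r - ln k))"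
    using pos by (simp add: exp_diff right_diff_distrib exp_of_nat_mult)
  finally have C: "real (2 * r choose k) \<le> 2 ^ k * exp (real k * (ln r - ln k) + real k)"
    by (simp add: exp_add mult.assoc)
  have "ln (real r / real k) \<le> real r / real k - 1" using pos by (intro ln_le_minus_one) auto
  then have "real k / real r * (ln r - ln k) \<le> real k / real r * (real r / real k - 1)"
    using pos by (intro mult_left_mono) (auto simp: ln_div)
  also have "\<dots> \<le> 1" using pos by (simp add: field_simps)
  finally have 1: "real k / real r * ln r \<le> 1 + real k / real r * ln k" by (simp add: algebra_simps)
  have lnk: "0 \<le> ln (real k)" using k by simp
  have "real k / real r * ln k \<le> 1 * ln k" using pos lnk by (intro mult_right_mono) auto
  moreover have "real k / real r * w \<le> 1 * w" using pos w by (intro mult_right_mono) auto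
  ultimately have "real k / real r * (ln r + w) \<le> 1 + ln k + w"
    using 1 by (simp add: distrib_left)
  then have 2: "real k / 2 * (real k / real r * (ln r + w)) \<le> real k / 2 * (1 + ln k + w)"
    using pos by (intro mult_left_mono) auto
  have "- p * (real r * real k - (real k)\<^sup>2 / 2) = - real k * (ln r + w) + real k / 2 * (real k / real r * (ln r + w))"
    unfolding p using pos by (simp add: field_simps power2_eq_square)
  also have "\<dots> \<le> - real k * (ln r + w) + real k / 2 * (1 + ln k + w)" using 2 by simp
  finally have "real k * (ln r - ln k) + real k + - p * (real r * real k - (real k)\<^sup>2 / 2) \<le>
      real k * (ln r - ln k) + real k + (- real k * (ln r + w) + real k / 2 * (1 + ln k + w))" by simp
  also have "\<dots> = real k * (3 / 2 - w / 2) - real k / 2 * ln k" by (simp add: field_simps)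
  also have "\<dots> \<le> real k * (3 / 2 - w / 2)" using lnk by simp
  finally have E: "real k * (ln r - ln k) + real k + - p * (real r * real k - (real k)\<^sup>2 / 2) \<le> real k * (3 / 2 - w / 2)" .
  have "real (2 * r choose k) * exp (- p * (real r * real k - (real k)\<^sup>2 / 2)) \<le>
      2 ^ k * exp (real k * (ln r - ln k) + real k) * exp (- p * (real r * real k - (real k)\<^sup>2 / 2))"
    using C by (intro mult_right_mono) auto
  also have "\<dots> = 2 ^ k * exp (real k * (ln r - ln k) + real k + - p * (real r * real k - (real k)\<^sup>2 / 2))"
    by (simp only: exp_add mult.assoc)
  also have "\<dots> \<le> 2 ^ k * exp (real k * (3 / 2 - w / 2))" using E by simp
  also have "\<dots> = (2 * exp (3 / 2 - w / 2)) ^ k" by (simp add: power_mult_distrib exp_of_nat_mult)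
  finally show ?thesis .
qed

lemma sum_cuts_le:
  assumes w: "0 \<le> w" and p: "p = (ln (real r) + w) / real r" "0 \<le> p" "p \<le> 1"
    and x: "x = 2 * exp (3 / 2 - w / 2)" "x \<le> 1 / 2"
  shows "(\<Sum>A | A \<subseteq> {..<r} <+> {..<r} \<and> A \<noteq> {} \<and> card A \<le> r. (1 - p) ^ card (bip_edge ` cut_pairs r A)) \<le> 2 * x"
proof -
  let ?V = "{..<r} <+> {..<r} :: (nat + nat) set"
  let ?A = "{A. A \<subseteq> ?V \<and> A \<noteq> {} \<and> card A \<le> r}"
  let ?g = "\<lambda>k. exp (- p * (real r * real k - (real k)\<^sup>2 / 2))"
  have fin: "finite ?A" by (rule finite_subset[of _ "Pow ?V"]) auto
  have "(\<Sum>A\<in>?A. (1 - p) ^ card (bip_edge ` cut_pairs r A)) \<le> (\<Sum>A\<in>?A. ?g (card A))"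
  proof (rule sum_mono)
    fix A assume "A \<in> ?A"
    then have c: "real r * card A - (real (card A))\<^sup>2 / 2 \<le> card (cut_pairs r A)" by (intro card_cut_pairs_ge) simp
    have "(1 - p) ^ card (bip_edge ` cut_pairs r A) \<le> exp (- p * card (cut_pairs r A))"
      unfolding card_bip_edge by (rule one_minus_power_le_exp[OF p(2,3)])
    also have "\<dots> \<le> ?g (card A)" using mult_left_mono[OF c p(2)] by simp
    finally show "(1 - p) ^ card (bip_edge ` cut_pairs r A) \<le> ?g (card A)" .
  qed
  also have "\<dots> = (\<Sum>k\<in>{1..r}. \<Sum>A | A \<in> ?A \<and> card A = k. ?g (card A))"
  proof (rule sum.group[symmetric, OF fin])
    show "card ` ?A \<subseteq> {1..r}"
    proof (rule image_subsetI)
      fix A assume A: "A \<in> ?A"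
      have "finite A" by (rule finite_subset[of _ ?V]) (use A in auto)
      then show "card A \<in> {1..r}" using A by (simp add: Suc_le_eq card_gt_0_iff)
    qed
  qed simp
  also have "\<dots> = (\<Sum>k\<in>{1..r}. real (2 * r choose k) * ?g k)"
  proof (rule sum.cong[OF refl])
    fix k assume k: "k \<in> {1..r}"
    have "(\<Sum>A | A \<in> ?A \<and> card A = k. ?g (card A)) = (\<Sum>A | A \<subseteq> ?V \<and> card A = k. ?g k)"
      by (rule sum.cong) (use k in auto)
    also have "\<dots> = real (card {A. A \<subseteq> ?V \<and> card A = k}) * ?g k" by simp
    also have "card {A. A \<subseteq> ?V \<and> card A = k} = 2 * r choose k"
      by (subst n_subsets) (simp_all add: card_Plus mult_2)
    finally show "(\<Sum>A | A \<in> ?A \<and> card A = k. ?g (card A)) = real (2 * r choose k) * ?g k" .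
  qed
  also have "\<dots> \<le> (\<Sum>k\<in>{1..r}. x ^ k)"
    unfolding x(1) by (rule sum_mono, rule cut_term_bound[OF _ _ w p(1)]) auto
  also have "\<dots> \<le> 2 * x"
  proof -
    have x0: "0 \<le> x" unfolding x(1) by simp
    have "(\<Sum>k\<in>{1..r}. x ^ k) = x * (\<Sum>k<r. x ^ k)"
      by (simp add: sum_distrib_left sum.atLeast1_atMost_eq)
    moreover have "(\<Sum>k<r. x ^ k) \<le> 2"
    proof -
      have "(\<Sum>k<r. x ^ k) \<le> (\<Sum>k<r. (1 / 2) ^ k)" using x0 x(2) by (intro sum_mono power_mono) auto
      also have "\<dots> \<le> 2" by (simp add: sum_gp_strict)
      finally show ?thesis .
    qed
    ultimately show ?thesis using mult_left_mono[of "\<Sum>k<r. x ^ k" 2 x] x0 by simp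
  qed
  finally show ?thesis .
qed

text \<open>The second error term is for holes: at most \<open>4 ^ r\<close> pairs of
  \<open>m\<close>-sets, each without edges with probability at most
  \<open>exp (- p * m * m)\<close>. Since \<open>m\<close> is linear in \<open>r\<close>, this
  exponent is of order \<open>r * ln r\<close> and eventually beats \<open>2 * r\<close>.\<close>

lemma prob_two_components_ge:
  assumes w: "0 \<le> w" and p: "p = (ln (real r) + w) / real r" "p \<le> 1"
    and x: "2 * exp (3 / 2 - w / 2) \<le> 1 / 2" and r: "1000 \<le> r"
  shows "1 - (4 * exp (3 / 2 - w / 2) + exp (2 * real r - real r * ln (real r) / 4000000)) \<le>
    measure_pmf.prob (random_edge_subgraph (complete_bipartite r r) p)
      {X. card (graph_components (FS X (complete_bipartite r r))) = 2}"
proof -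
  let ?K = "complete_bipartite r r"
  let ?V = "{..<r} <+> {..<r} :: (nat + nat) set"
  let ?P = "measure_pmf.prob (random_edge_subgraph ?K p)"
  \<comment> \<open>Small enough for \<open>700 * m \<le> r\<close>, yet at least
    \<open>r / 2000\<close>, whence \<open>4000000 = 2000 * 2000\<close>.\<close>
  define m where "m = r div 1000"
  have r_eq: "r = 1000 * m + r mod 1000" "r mod 1000 < 1000" unfolding m_def by simp_all
  then have "1 \<le> m" using r by linarith
  then have m: "1 \<le> m" "700 * m \<le> r" "r \<le> 2000 * m" using r_eq by linarith+
  have p0: "0 \<le> p" unfolding p(1) using w r by simp
  let ?A = "{A. A \<subseteq> ?V \<and> A \<noteq> {} \<and> card A \<le> r}"
  let ?H = "{A. A \<subseteq> {..<r} \<and> card A = m}"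
  let ?B1 = "{X. \<exists>A\<in>?A. edges X \<inter> bip_edge ` cut_pairs r A = {}}"
  let ?B2 = "{X. \<exists>Q\<in>?H \<times> ?H. edges X \<inter> bip_edge ` (fst Q \<times> snd Q) = {}}"
  have fA: "finite ?A" by (rule finite_subset[of _ "Pow ?V"]) auto
  have fH: "finite ?H" by (rule finite_subset[of _ "Pow {..<r}"]) auto
  have "?P ?B1 \<le> (\<Sum>A\<in>?A. (1 - p) ^ card (bip_edge ` cut_pairs r A))"
  proof (rule prob_some_avoided_le[OF finite_edges_complete_bipartite p0 p(2) fA])
    show "bip_edge ` cut_pairs r A \<subseteq> edges ?K" for A
      unfolding edges_complete_bipartite by (rule image_mono) (auto simp: cut_pairs_def)
  qed
  also have "\<dots> \<le> 2 * (2 * exp (3 / 2 - w / 2))" by (rule sum_cuts_le[OF w p(1) p0 p(2) refl x])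
  finally have B1: "?P ?B1 \<le> 4 * exp (3 / 2 - w / 2)" by simp
  have "?P ?B2 \<le> (\<Sum>Q\<in>?H \<times> ?H. (1 - p) ^ card (bip_edge ` (fst Q \<times> snd Q)))"
  proof (rule prob_some_avoided_le[OF finite_edges_complete_bipartite p0 p(2)])
    show "bip_edge ` (fst Q \<times> snd Q) \<subseteq> edges ?K" if "Q \<in> ?H \<times> ?H" for Q
      unfolding edges_complete_bipartite by (rule image_mono) (use that in auto)
  qed (use fH in simp)
  also have "\<dots> = (\<Sum>Q\<in>?H \<times> ?H. (1 - p) ^ (m * m))"
    by (rule sum.cong[OF refl]) (auto simp: card_bip_edge card_cartesian_product)
  also have "\<dots> = real (card ?H * card ?H) * (1 - p) ^ (m * m)" by (simp add: card_cartesian_product)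
  also have "\<dots> \<le> exp (2 * real r) * exp (- p * real (m * m))"
  proof (rule mult_mono)
    have "card ?H \<le> card (Pow {..<r})" by (rule card_mono) auto
    then have "card ?H * card ?H \<le> 2 ^ r * 2 ^ r" by (intro mult_mono) (simp_all add: card_Pow)
    then have "real (card ?H * card ?H) \<le> 2 ^ r * 2 ^ r"
      by (metis (mono_tags, lifting) of_nat_le_iff of_nat_mult of_nat_numeral of_nat_power)
    also have "\<dots> \<le> exp 1 ^ r * exp 1 ^ r"
      using exp_ge_add_one_self[of 1] by (intro mult_mono power_mono) auto
    also have "\<dots> = exp (2 * real r)" by (simp add: exp_of_nat_mult[symmetric] exp_add[symmetric])
    finally show "real (card ?H * card ?H) \<le> exp (2 * real r)" .
    show "(1 - p) ^ (m * m) \<le> exp (- p * real (m * m))" by (rule one_minus_power_le_exp[OF p0 p(2)])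
  qed (use p(2) in auto)
  also have "\<dots> \<le> exp (2 * real r - real r * ln (real r) / 4000000)"
  proof -
    have "real r * real r \<le> real (2000 * m) * real (2000 * m)"
      using m(3) by (intro mult_mono) (simp_all only: of_nat_le_iff of_nat_0_le_iff)
    then have "real r * real r / 4000000 \<le> real (m * m)" by simp
    moreover have "ln (real r) / real r \<le> p" unfolding p(1) using w by (intro divide_right_mono) auto
    ultimately have "ln (real r) / real r * (real r * real r / 4000000) \<le> p * real (m * m)"
      using p0 r by (intro mult_mono) auto
    moreover have "ln (real r) / real r * (real r * real r / 4000000) = real r * ln (real r) / 4000000"
      using r by simp
    ultimately show ?thesis by (simp add: exp_add[symmetric])
  qed
  finally have B2: "?P ?B2 \<le> exp (2 * real r - real r * ln (real r) / 4000000)" .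
  have "?P (?B1 \<union> ?B2) \<le> ?P ?B1 + ?P ?B2" by (rule measure_Un_le) auto
  with B1 B2 have "?P (?B1 \<union> ?B2) \<le> 4 * exp (3 / 2 - w / 2) + exp (2 * real r - real r * ln (real r) / 4000000)"
    by linarith
  moreover have "1 - ?P (?B1 \<union> ?B2) \<le> ?P {X. card (graph_components (FS X ?K)) = 2}"
  proof (rule prob_ge_one_minus)
    fix X assume "X \<in> set_pmf (random_edge_subgraph ?K p)" and nB: "X \<notin> ?B1 \<union> ?B2"
    then have X: "X \<in> edge_subgraphs ?K" using set_random_edge_subgraph by blast
    have cuts: "edges X \<inter> bip_edge ` cut_pairs r A \<noteq> {}" if "A \<subseteq> ?V" "A \<noteq> {}" "card A \<le> r" for A
      using nB that by blast
    have holes: "edges X \<inter> bip_edge ` (A \<times> B) \<noteq> {}"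
      if "A \<subseteq> {..<r}" "B \<subseteq> {..<r}" "card A = m" "card B = m" for A B
    proof
      assume "edges X \<inter> bip_edge ` (A \<times> B) = {}"
      then have "X \<in> ?B2" using that by (intro CollectI bexI[of _ "(A, B)"]) auto
      then show False using nB by blast
    qed
    have "card (graph_components (FS X ?K)) = 2"
      by (rule card_components_eq_2[OF X _ full_of_no_empty_cut_no_hole[OF X m(1,2) cuts holes]])
        (use r in auto)
    then show "X \<in> {X. card (graph_components (FS X ?K)) = 2}" by simp
  qed
  ultimately show ?thesis by linarith
qed

section \<open>Passing to the limit\<close>

text \<open>The expected number \<open>r * (1 - p) ^ r\<close> of isolated left vertices is at least
  \<open>exp (w - 1)\<close>: as \<open>r * p = ln r - w\<close>, only the quadratic error in
  \<open>ln (1 - p)\<close> is lost, and in total it is at most 1. Weakening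
  \<open>exp (w - 1)\<close> to \<open>w\<close> gives the simple bound.\<close>

lemma no_isolated_bound:
  assumes p: "p = (ln (real r) - w) / real r" "0 \<le> p" and w: "0 \<le> w" and r: "1 \<le> r"
    and "ln (real r) / real r \<le> 1 / 2" "2 * (ln (real r))\<^sup>2 / real r \<le> 1"
  shows "(1 - (1 - p) ^ r) ^ r \<le> exp (- w)"
proof -
  have le: "p \<le> ln (real r) / real r" unfolding p(1) using w by (intro divide_right_mono) auto
  then have half: "p \<le> 1 / 2" using assms(5) by linarith
  have "real r * p\<^sup>2 \<le> real r * (ln (real r) / real r)\<^sup>2"
    using le p(2) by (intro mult_left_mono power_mono) auto
  also have "real r * (ln (real r) / real r)\<^sup>2 = (ln (real r))\<^sup>2 / real r"
    using r by (simp add: power2_eq_square)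
  finally have sq: "2 * (real r * p\<^sup>2) \<le> 1" using assms(6) by linarith
  have "- p - 2 * p\<^sup>2 \<le> ln (1 - p)" using p(2) half by (rule ln_one_minus_pos_lower_bound)
  then have "real r * (- p - 2 * p\<^sup>2) \<le> real r * ln (1 - p)" by (intro mult_left_mono) auto
  moreover have "real r * p = ln (real r) - w" unfolding p(1) using r by simp
  ultimately have "w - 1 - ln (real r) \<le> real r * ln (1 - p)" using sq by (simp add: algebra_simps)
  then have "exp (w - 1 - ln (real r)) \<le> exp (real r * ln (1 - p))" by simp
  also have "\<dots> = (1 - p) ^ r" using half by (simp add: exp_of_nat_mult)
  finally have "exp (w - 1) / real r \<le> (1 - p) ^ r" using r by (simp add: exp_diff)
  then have "exp (w - 1) \<le> (1 - p) ^ r * real r" using r by (simp add: pos_divide_le_eq)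
  moreover have "w \<le> exp (w - 1)" using exp_ge_add_one_self[of "w - 1"] by simp
  ultimately have q: "w \<le> (1 - p) ^ r * real r" by linarith
  have "0 \<le> (1 - p) ^ r" "(1 - p) ^ r \<le> 1" using p(2) half by (auto intro: power_le_one)
  then have "(1 - (1 - p) ^ r) ^ r \<le> exp (- ((1 - p) ^ r) * real r)" by (rule one_minus_power_le_exp)
  also have "\<dots> \<le> exp (- w)" using q by simp
  finally show ?thesis .
qed

theorem theorem1p5:
  fixes p \<omega> :: "nat \<Rightarrow> real"
  assumes "filterlim \<omega> at_top sequentially"
  shows "((\<forall>\<^sub>F r in sequentially. p r = (ln (real r) - \<omega> r) / real r \<and> p r \<ge> 0) \<longrightarrow>
           (\<lambda>r. measure_pmf.prob (random_edge_subgraph (complete_bipartite r r) (p r))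
                  {X. card (graph_components (FS X (complete_bipartite r r))) > 2}) \<longlonglongrightarrow> 1) \<and>
         ((\<forall>\<^sub>F r in sequentially. p r = (ln (real r) + \<omega> r) / real r \<and> p r \<le> 1) \<longrightarrow>
           (\<lambda>r. measure_pmf.prob (random_edge_subgraph (complete_bipartite r r) (p r))
                  {X. card (graph_components (FS X (complete_bipartite r r))) = 2}) \<longlonglongrightarrow> 1)"
proof (intro conjI impI)
  have w0: "\<forall>\<^sub>F r in sequentially. 0 \<le> \<omega> r"
    using assms by (simp add: filterlim_at_top)
  assume p: "\<forall>\<^sub>F r in sequentially. p r = (ln (real r) - \<omega> r) / real r \<and> p r \<ge> 0"
  have "\<forall>\<^sub>F r in sequentially. ln (real r) / real r \<le> 1 / 2" by real_asymp
  moreover have "\<forall>\<^sub>F r in sequentially. 2 * (ln (real r))\<^sup>2 / real r \<le> 1" by real_asymp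
  ultimately have lower: "\<forall>\<^sub>F r in sequentially. 1 - exp (- \<omega> r) \<le>
      measure_pmf.prob (random_edge_subgraph (complete_bipartite r r) (p r))
        {X. card (graph_components (FS X (complete_bipartite r r))) > 2}"
    using p w0 eventually_ge_at_top[of 2]
  proof eventually_elim
    case (elim r)
    \<comment> \<open>In this case \<open>p r \<le> 1\<close> has to be derived; it follows from
      \<open>\<omega> r \<ge> 0\<close> and \<open>ln r / r \<le> 1 / 2\<close>.\<close>
    have "p r \<le> ln (real r) / real r" using elim by (simp add: divide_right_mono)
    then have "p r \<le> 1" using elim by linarith
    then have "1 - (1 - (1 - p r) ^ r) ^ r \<le>
      measure_pmf.prob (random_edge_subgraph (complete_bipartite r r) (p r))
        {X. card (graph_components (FS X (complete_bipartite r r))) > 2}"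
      using elim by (intro prob_many_components_ge) auto
    moreover have "(1 - (1 - p r) ^ r) ^ r \<le> exp (- \<omega> r)"
      using elim by (intro no_isolated_bound) auto
    ultimately show ?case by linarith
  qed
  have lim: "(\<lambda>r. 1 - exp (- \<omega> r)) \<longlonglongrightarrow> 1 - 0"
    using assms
    by (intro tendsto_diff tendsto_const filterlim_compose[OF exp_at_bot])
      (simp add: filterlim_uminus_at_bot)
  show "(\<lambda>r. measure_pmf.prob (random_edge_subgraph (complete_bipartite r r) (p r))
      {X. card (graph_components (FS X (complete_bipartite r r))) > 2}) \<longlonglongrightarrow> 1"
    by (rule tendsto_sandwich[OF lower always_eventually lim[simplified] tendsto_const]) simp
next
  assume p: "\<forall>\<^sub>F r in sequentially. p r = (ln (real r) + \<omega> r) / real r \<and> p r \<le> 1"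
  let ?e = "\<lambda>r. 4 * exp (3 / 2 - \<omega> r / 2) + exp (2 * real r - real r * ln (real r) / 4000000)"
  have "((\<lambda>w::real. 4 * exp (3 / 2 - w / 2)) \<longlongrightarrow> 0) at_top" by real_asymp
  then have e1: "(\<lambda>r. 4 * exp (3 / 2 - \<omega> r / 2)) \<longlonglongrightarrow> 0" using assms by (rule filterlim_compose)
  have e2: "(\<lambda>r. exp (2 * real r - real r * ln (real r) / 4000000)) \<longlonglongrightarrow> 0" by real_asymp
  \<comment> \<open>This provides the ratio at most \<open>1 / 2\<close> of the geometric series
    over cut sizes.\<close>
  have "\<forall>\<^sub>F r in sequentially. 4 * exp (3 / 2 - \<omega> r / 2) < 1" using e1 by (rule order_tendstoD) simp
  moreover have "\<forall>\<^sub>F r in sequentially. 0 \<le> \<omega> r"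
    using assms by (simp add: filterlim_at_top)
  ultimately have lower: "\<forall>\<^sub>F r in sequentially. 1 - ?e r \<le>
      measure_pmf.prob (random_edge_subgraph (complete_bipartite r r) (p r))
        {X. card (graph_components (FS X (complete_bipartite r r))) = 2}"
    using p eventually_ge_at_top[of 1000]
  proof eventually_elim
    case (elim r)
    then show ?case by (intro prob_two_components_ge) auto
  qed
  have lim: "(\<lambda>r. 1 - ?e r) \<longlonglongrightarrow> 1 - (0 + 0)"
    by (intro tendsto_diff tendsto_add tendsto_const e1 e2)
  show "(\<lambda>r. measure_pmf.prob (random_edge_subgraph (complete_bipartite r r) (p r))
      {X. card (graph_components (FS X (complete_bipartite r r))) = 2}) \<longlonglongrightarrow> 1"
    by (rule tendsto_sandwich[OF lower always_eventually lim[simplified] tendsto_const]) simp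
qed

end
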